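(* Let $m\ge1$, $d\ge2$, $k_1,\dots,k_m\geq 2$ be integers, and let $$X=\{xy_1^{k_1}\cdots y_m^{k_m}=P(y_1,\dots,y_m,z)\}\subset\mathbb{K}^{m+2},$$ $$P=z^d+s_{d-1}(y_1,\dots,y_m)z^{d-1}+\dots+s_0(y_1,\dots,y_m),\quad s_j\in\mathbb{K}[y_1,\dots,y_m],$$ be a Danielewski variety. Then every automorphism $\psi$ of $X$ preserves the filtration $\{\mathbb{K}[X]_i\}_{i\in\mathbb{Z}}$ of $\mathbb{K}[X]$ induced by the canonical locally nilpotent derivation $\widetilde{\partial}$, that is, $\psi^*(\mathbb{K}[X]_i)=\mathbb{K}[X]_i$ for all $i$.
   Context: $\mathbb{K}$ is an algebraically closed field of characteristic zero. A derivation is locally nilpotent (LND) if each element is annihilated by some power of it. The canonical LND $\widetilde{\partial}$ of $\mathbb{K}[X]$ is given by $\widetilde{\partial}(y_i)=0$ for all $i$, $\widetilde{\partial}(z)=y_1^{k_1}\cdots y_m^{k_m}$, $\widetilde{\partial}(x)=\frac{\partial P}{\partial z}$. It induces a degree function on $\mathbb{K}[X]\setminus\{0\}$: $\widetilde{\deg}(f)=p$ if $\widetilde{\partial}^p(f)\neq0$ and $\widetilde{\partial}^{p+1}(f)=0$. The filtration is $\mathbb{K}[X]_i=\{f\in\mathbb{K}[X]\setminus\{0\}\mid\widetilde{\deg}(f)\leq i\}\cup\{0\}$, $i\in\mathbb{Z}$. For $\psi\in\mathrm{Aut}(X)$, $\psi^*$ is the induced automorphism of $\mathbb{K}[X]$.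 *)

theory Defs
  imports
    "HOL-Library.Poly_Mapping"
    "HOL-Library.FuncSet"
    "HOL-Computational_Algebra.Polynomial"
begin

section \<open>Regular functions and automorphisms of closed subsets of affine space\<close>

text \<open>
  A polynomial over \<open>'k\<close> in variables indexed by \<open>'v\<close> is an element of
  \<open>('v \<Rightarrow>\<^sub>0 nat) \<Rightarrow>\<^sub>0 'k\<close>.  The points of the affine space with coordinates
  indexed by \<open>'v\<close> are the functions \<open>'v \<Rightarrow> 'k\<close>.
\<close>

definition mpoly_eval :: "(('v \<Rightarrow>\<^sub>0 nat) \<Rightarrow>\<^sub>0 'k::comm_ring_1) \<Rightarrow> ('v \<Rightarrow> 'k) \<Rightarrow> 'k" where
  "mpoly_eval F p =
     (\<Sum>m\<in>Poly_Mapping.keys F. Poly_Mapping.lookup F m *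
        (\<Prod>v\<in>Poly_Mapping.keys m. p v ^ Poly_Mapping.lookup m v))"

text \<open>
  The algebra \<open>\<K>[X]\<close> of a closed subset \<open>X\<close>, realised as functions on \<open>X\<close>.  Functions on
  \<open>X\<close> are extensional in the sense of FuncSet (\<open>undefined\<close> outside \<open>X\<close>), so that
  equality of elements of \<open>\<K>[X]\<close> is equality of functions on \<open>X\<close>; the zero element is
  \<open>\<lambda>p\<in>X. 0\<close> and sums and products are \<open>\<lambda>p\<in>X. f p + g p\<close> and \<open>\<lambda>p\<in>X. f p * g p\<close>.
\<close>

definition regular_functions :: "('v \<Rightarrow> 'k::comm_ring_1) set \<Rightarrow> (('v \<Rightarrow> 'k) \<Rightarrow> 'k) set" where
  "regular_functions X = {(\<lambda>p\<in>X. mpoly_eval F p) | F. True}"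

definition morphism ::
  "('v \<Rightarrow> 'k::comm_ring_1) set \<Rightarrow> ('w \<Rightarrow> 'k) set \<Rightarrow> (('v \<Rightarrow> 'k) \<Rightarrow> ('w \<Rightarrow> 'k)) \<Rightarrow> bool" where
  "morphism X Y \<psi> \<longleftrightarrow>
     \<psi> \<in> X \<rightarrow> Y \<and> (\<forall>w. (\<lambda>p\<in>X. \<psi> p w) \<in> regular_functions X)"

definition automorphism ::
  "('v \<Rightarrow> 'k::comm_ring_1) set \<Rightarrow> (('v \<Rightarrow> 'k) \<Rightarrow> ('v \<Rightarrow> 'k)) \<Rightarrow> bool" where
  "automorphism X \<psi> \<longleftrightarrow> morphism X X \<psi> \<and>
     (\<exists>\<phi>. morphism X X \<phi> \<and> (\<forall>p\<in>X. \<phi> (\<psi> p) = p \<and> \<psi> (\<phi> p) = p))"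

text \<open>The induced map \<open>\<psi>\<^sup>*\<close> on functions.\<close>

definition pullback ::
  "('v \<Rightarrow> 'k) set \<Rightarrow> (('v \<Rightarrow> 'k) \<Rightarrow> ('v \<Rightarrow> 'k)) \<Rightarrow> (('v \<Rightarrow> 'k) \<Rightarrow> 'k) \<Rightarrow> (('v \<Rightarrow> 'k) \<Rightarrow> 'k)" where
  "pullback X \<psi> f = (\<lambda>p\<in>X. f (\<psi> p))"


section \<open>Derivations, degree functions and filtrations\<close>

definition derivation ::
  "('v \<Rightarrow> 'k::comm_ring_1) set \<Rightarrow> ((('v \<Rightarrow> 'k) \<Rightarrow> 'k) \<Rightarrow> (('v \<Rightarrow> 'k) \<Rightarrow> 'k)) \<Rightarrow> bool" where
  "derivation X D \<longleftrightarrow>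
     D \<in> regular_functions X \<rightarrow> regular_functions X \<and>
     (\<forall>f\<in>regular_functions X. \<forall>g\<in>regular_functions X.
        D (\<lambda>p\<in>X. f p + g p) = (\<lambda>p\<in>X. D f p + D g p) \<and>
        D (\<lambda>p\<in>X. f p * g p) = (\<lambda>p\<in>X. D f p * g p + f p * D g p)) \<and>
     (\<forall>c. \<forall>f\<in>regular_functions X. D (\<lambda>p\<in>X. c * f p) = (\<lambda>p\<in>X. c * D f p))"

text \<open>Only meaningful for nonzero \<open>f\<close> annihilated by some power of \<open>D\<close>.\<close>

definition degree_fun ::
  "('v \<Rightarrow> 'k::comm_ring_1) set \<Rightarrow> ((('v \<Rightarrow> 'k) \<Rightarrow> 'k) \<Rightarrow> (('v \<Rightarrow> 'k) \<Rightarrow> 'k)) \<Rightarrow>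
     (('v \<Rightarrow> 'k) \<Rightarrow> 'k) \<Rightarrow> nat" where
  "degree_fun X D f =
     (THE n. (D ^^ n) f \<noteq> (\<lambda>p\<in>X. 0) \<and> (D ^^ (n + 1)) f = (\<lambda>p\<in>X. 0))"

definition filtration ::
  "('v \<Rightarrow> 'k::comm_ring_1) set \<Rightarrow> ((('v \<Rightarrow> 'k) \<Rightarrow> 'k) \<Rightarrow> (('v \<Rightarrow> 'k) \<Rightarrow> 'k)) \<Rightarrow>
     int \<Rightarrow> (('v \<Rightarrow> 'k) \<Rightarrow> 'k) set" where
  "filtration X D i =
     {f \<in> regular_functions X - {\<lambda>p\<in>X. 0}. int (degree_fun X D f) \<le> i} \<union> {\<lambda>p\<in>X. 0}"


section \<open>Danielewski varieties\<close>

text \<open>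
  Names of the \<open>m + 2\<close> coordinates \<open>x, y\<^sub>1, \<dots>, y\<^sub>m, z\<close>, where \<open>m\<close> is the
  cardinality of the finite type \<open>'n\<close>.
\<close>

datatype 'n coord = Cx | Cy 'n | Cz

text \<open>
  The polynomial \<open>P(y\<^sub>1, \<dots>, y\<^sub>m, z) = z^d + s\<^bsub>d-1\<^esub>(y) z^(d-1) + \<dots> + s\<^sub>0(y)\<close>,
  as an element of \<open>\<K>[z]\<close> for each fixed value of \<open>y\<close>.
\<close>

definition dan_poly ::
  "nat \<Rightarrow> (nat \<Rightarrow> ('n \<Rightarrow>\<^sub>0 nat) \<Rightarrow>\<^sub>0 'k::comm_ring_1) \<Rightarrow> ('n \<Rightarrow> 'k) \<Rightarrow> 'k poly" where
  "dan_poly d s y = monom 1 d + (\<Sum>j<d. monom (mpoly_eval (s j) y) j)"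

definition danielewski ::
  "('n::finite \<Rightarrow> nat) \<Rightarrow> nat \<Rightarrow> (nat \<Rightarrow> ('n \<Rightarrow>\<^sub>0 nat) \<Rightarrow>\<^sub>0 'k::comm_ring_1) \<Rightarrow>
     ('n coord \<Rightarrow> 'k) set" where
  "danielewski k d s =
     {p. p Cx * (\<Prod>i\<in>UNIV. p (Cy i) ^ k i) = poly (dan_poly d s (\<lambda>i. p (Cy i))) (p Cz)}"

text \<open>
  The values on the generators \<open>x, y\<^sub>i, z\<close> determine the derivation; for its existence see
  below.  It is locally nilpotent because each generator is annihilated by a power of it.
\<close>

definition canonical_LND ::
  "('n::finite \<Rightarrow> nat) \<Rightarrow> nat \<Rightarrow> (nat \<Rightarrow> ('n \<Rightarrow>\<^sub>0 nat) \<Rightarrow>\<^sub>0 'k::field) \<Rightarrow>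
     ((('n coord \<Rightarrow> 'k) \<Rightarrow> 'k) \<Rightarrow> (('n coord \<Rightarrow> 'k) \<Rightarrow> 'k)) \<Rightarrow> bool" where
  "canonical_LND k d s D \<longleftrightarrow>
     (let X = danielewski k d s in
       derivation X D \<and>
       (\<forall>i. D (\<lambda>p\<in>X. p (Cy i)) = (\<lambda>p\<in>X. 0)) \<and>
       D (\<lambda>p\<in>X. p Cz) = (\<lambda>p\<in>X. \<Prod>i\<in>UNIV. p (Cy i) ^ k i) \<and>
       D (\<lambda>p\<in>X. p Cx) = (\<lambda>p\<in>X. poly (pderiv (dan_poly d s (\<lambda>i. p (Cy i)))) (p Cz)))"


section \<open>Existence of the canonical derivation\<close>

lemma mpoly_eval_superset:
  assumes "finite A" "Poly_Mapping.keys F \<subseteq> A"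
  shows "mpoly_eval F p = (\<Sum>m\<in>A. Poly_Mapping.lookup F m *
           (\<Prod>v\<in>Poly_Mapping.keys m. p v ^ Poly_Mapping.lookup m v))"
  unfolding mpoly_eval_def
  by (rule sum.mono_neutral_left) (use assms in \<open>auto simp: in_keys_iff\<close>)

lemma mpoly_eval_add: "mpoly_eval (F + G) p = mpoly_eval F p + mpoly_eval G p"
proof -
  let ?A = "Poly_Mapping.keys F \<union> Poly_Mapping.keys G"
  have "finite ?A" "Poly_Mapping.keys F \<subseteq> ?A" "Poly_Mapping.keys G \<subseteq> ?A"
    "Poly_Mapping.keys (F + G) \<subseteq> ?A"
    using Poly_Mapping.keys_add[of F G] by auto
  then show ?thesis
    by (simp add: mpoly_eval_superset[of ?A] lookup_add distrib_right sum.distrib)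
qed

lemma mpoly_eval_sum: "mpoly_eval (sum F I) p = (\<Sum>i\<in>I. mpoly_eval (F i) p)"
proof -
  have "mpoly_eval 0 p = 0" by (simp add: mpoly_eval_def)
  then show ?thesis
    by (induction I rule: infinite_finite_induct) (simp_all add: mpoly_eval_add)
qed

lemma mpoly_eval_single:
  "mpoly_eval (Poly_Mapping.single m c) p =
     c * (\<Prod>v\<in>Poly_Mapping.keys m. p v ^ Poly_Mapping.lookup m v)"
  by (subst mpoly_eval_superset[of "{m}"]) auto

lemma monom_eval_add:
  fixes p :: "'v \<Rightarrow> 'k::comm_ring_1" and m n :: "'v \<Rightarrow>\<^sub>0 nat"
  shows "(\<Prod>v\<in>Poly_Mapping.keys (m + n). p v ^ Poly_Mapping.lookup (m + n) v) =
         (\<Prod>v\<in>Poly_Mapping.keys m. p v ^ Poly_Mapping.lookup m v) *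
         (\<Prod>v\<in>Poly_Mapping.keys n. p v ^ Poly_Mapping.lookup n v)"
proof -
  let ?A = "Poly_Mapping.keys m \<union> Poly_Mapping.keys n"
  have *: "(\<Prod>v\<in>Poly_Mapping.keys l. p v ^ Poly_Mapping.lookup l v) =
           (\<Prod>v\<in>?A. p v ^ Poly_Mapping.lookup l v)"
    if "Poly_Mapping.keys l \<subseteq> ?A" for l :: "'v \<Rightarrow>\<^sub>0 nat"
    by (rule prod.mono_neutral_left) (use that in \<open>auto simp: in_keys_iff\<close>)
  show ?thesis
    unfolding *[OF Poly_Mapping.keys_add] *[OF Un_upper1] *[OF Un_upper2]
    by (simp add: lookup_add power_add prod.distrib)
qed

lemma poly_mapping_sum_single:
  "F = (\<Sum>m\<in>Poly_Mapping.keys F. Poly_Mapping.single m (Poly_Mapping.lookup F m))"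
  by (rule poly_mapping_eqI) (auto simp: lookup_sum lookup_single when_def in_keys_iff)

lemma mpoly_eval_mult: "mpoly_eval (F * G) p = mpoly_eval F p * mpoly_eval G p"
proof -
  have "F * G = (\<Sum>m\<in>Poly_Mapping.keys F. \<Sum>n\<in>Poly_Mapping.keys G.
      Poly_Mapping.single (m + n) (Poly_Mapping.lookup F m * Poly_Mapping.lookup G n))"
    by (subst (1) poly_mapping_sum_single[of F], subst (1) poly_mapping_sum_single[of G])
       (simp add: sum_product mult_single)
  then show ?thesis
    by (simp add: mpoly_eval_sum mpoly_eval_single monom_eval_add)
       (simp add: mpoly_eval_def sum_product mult_ac)
qed

lemma regular_functions_mpoly_eval [intro]: "(\<lambda>p\<in>X. mpoly_eval F p) \<in> regular_functions X"
  by (auto simp: regular_functions_def)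

lemma regular_functions_const [intro]: "(\<lambda>p\<in>X. c) \<in> regular_functions X"
  using regular_functions_mpoly_eval[where X = X and F = "Poly_Mapping.single 0 c"]
  by (simp add: mpoly_eval_single)

lemma regular_functions_coord [intro]: "(\<lambda>p\<in>X. p v) \<in> regular_functions X"
  using regular_functions_mpoly_eval[where X = X and F = "Poly_Mapping.single (Poly_Mapping.single v 1) 1"]
  by (simp add: mpoly_eval_single)

lemma regular_functions_add:
  assumes "(\<lambda>p\<in>X. f p) \<in> regular_functions X" "(\<lambda>p\<in>X. g p) \<in> regular_functions X"
  shows "(\<lambda>p\<in>X. f p + g p) \<in> regular_functions X"
proof -
  obtain F G where "(\<lambda>p\<in>X. f p) = (\<lambda>p\<in>X. mpoly_eval F p)" "(\<lambda>p\<in>X. g p) = (\<lambda>p\<in>X. mpoly_eval G p)"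
    using assms by (auto simp: regular_functions_def)
  then have "(\<lambda>p\<in>X. f p + g p) = (\<lambda>p\<in>X. mpoly_eval (F + G) p)"
    by (auto simp: mpoly_eval_add fun_eq_iff restrict_def split: if_splits)
  then show ?thesis by auto
qed

lemma regular_functions_mult:
  assumes "(\<lambda>p\<in>X. f p) \<in> regular_functions X" "(\<lambda>p\<in>X. g p) \<in> regular_functions X"
  shows "(\<lambda>p\<in>X. f p * g p) \<in> regular_functions X"
proof -
  obtain F G where "(\<lambda>p\<in>X. f p) = (\<lambda>p\<in>X. mpoly_eval F p)" "(\<lambda>p\<in>X. g p) = (\<lambda>p\<in>X. mpoly_eval G p)"
    using assms by (auto simp: regular_functions_def)
  then have "(\<lambda>p\<in>X. f p * g p) = (\<lambda>p\<in>X. mpoly_eval (F * G) p)"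
    by (auto simp: mpoly_eval_mult fun_eq_iff restrict_def split: if_splits)
  then show ?thesis by auto
qed

lemma regular_functions_restrict:
  "f \<in> regular_functions X \<Longrightarrow> (\<lambda>p\<in>X. f p) = f"
  by (auto simp: regular_functions_def)

lemma regular_functions_sum:
  assumes "\<And>i. i \<in> I \<Longrightarrow> (\<lambda>p\<in>X. f i p) \<in> regular_functions X"
  shows "(\<lambda>p\<in>X. \<Sum>i\<in>I. f i p) \<in> regular_functions X"
  using assms
  by (induction I rule: infinite_finite_induct) (auto intro: regular_functions_add)

lemma regular_functions_prod:
  assumes "\<And>i. i \<in> I \<Longrightarrow> (\<lambda>p\<in>X. f i p) \<in> regular_functions X"
  shows "(\<lambda>p\<in>X. \<Prod>i\<in>I. f i p) \<in> regular_functions X"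
  using assms
  by (induction I rule: infinite_finite_induct) (auto intro: regular_functions_mult)

lemma regular_functions_power:
  assumes "(\<lambda>p\<in>X. f p) \<in> regular_functions X"
  shows "(\<lambda>p\<in>X. f p ^ n) \<in> regular_functions X"
  using assms by (induction n) (auto intro: regular_functions_mult)

lemma regular_functions_compose:
  assumes "\<And>v. (\<lambda>p\<in>X. g p v) \<in> regular_functions X"
  shows "(\<lambda>p\<in>X. mpoly_eval F (g p)) \<in> regular_functions X"
  unfolding mpoly_eval_def
  by (intro regular_functions_sum regular_functions_mult regular_functions_prod
      regular_functions_power regular_functions_const assms)

lemma regular_functions_induct [consumes 1, case_names const coord add mult]:
  assumes f: "f \<in> regular_functions X"
    and const: "\<And>c. S (\<lambda>p\<in>X. c)"
    and coord: "\<And>v. S (\<lambda>p\<in>X. p v)"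
    and add: "\<And>f g. f \<in> regular_functions X \<Longrightarrow> g \<in> regular_functions X \<Longrightarrow>
                S f \<Longrightarrow> S g \<Longrightarrow> S (\<lambda>p\<in>X. f p + g p)"
    and mult: "\<And>f g. f \<in> regular_functions X \<Longrightarrow> g \<in> regular_functions X \<Longrightarrow>
                S f \<Longrightarrow> S g \<Longrightarrow> S (\<lambda>p\<in>X. f p * g p)"
  shows "S f"
proof -
  define R where "R f \<longleftrightarrow> (\<lambda>p\<in>X. f p) \<in> regular_functions X \<and> S (\<lambda>p\<in>X. f p)" for f
  have rw: "(\<lambda>p\<in>X. (\<lambda>p\<in>X. f p) p + (\<lambda>p\<in>X. g p) p) = (\<lambda>p\<in>X. f p + g p)"
    "(\<lambda>p\<in>X. (\<lambda>p\<in>X. f p) p * (\<lambda>p\<in>X. g p) p) = (\<lambda>p\<in>X. f p * g p)" for f g :: "_ \<Rightarrow> 'b"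
    by (auto simp: restrict_def)
  have R: "R (\<lambda>p. c)" "R (\<lambda>p. p v)" "R f \<Longrightarrow> R g \<Longrightarrow> R (\<lambda>p. f p + g p)"
    "R f \<Longrightarrow> R g \<Longrightarrow> R (\<lambda>p. f p * g p)" for c v f g
    using const coord add[of "\<lambda>p\<in>X. f p" "\<lambda>p\<in>X. g p"] mult[of "\<lambda>p\<in>X. f p" "\<lambda>p\<in>X. g p"]
    unfolding R_def rw by (auto intro: regular_functions_add regular_functions_mult)
  have sum: "R (\<lambda>p. \<Sum>i\<in>I. g i p)" if "\<And>i. i \<in> I \<Longrightarrow> R (g i)" for g and I :: "'c set"
    using that by (induction I rule: infinite_finite_induct) (auto intro: R)
  have prod: "R (\<lambda>p. \<Prod>i\<in>I. g i p)" if "\<And>i. i \<in> I \<Longrightarrow> R (g i)" for g and I :: "'d set"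
    using that by (induction I rule: infinite_finite_induct) (auto intro: R)
  have power: "R (\<lambda>p. g p ^ n)" if "R g" for g n
    using that by (induction n) (auto intro: R)
  obtain F where F: "f = (\<lambda>p\<in>X. mpoly_eval F p)"
    using f by (auto simp: regular_functions_def)
  have "R (\<lambda>p. mpoly_eval F p)"
    unfolding mpoly_eval_def by (intro sum R prod power)
  then show ?thesis by (simp add: F R_def)
qed

text \<open>
  The canonical derivation is the derivative at \<open>t = 0\<close> along an action of the additive
  group on the variety with \<open>y \<mapsto> y\<close> and \<open>z \<mapsto> z + t y\<^sub>1^k\<^sub>1 \<dots> y\<^sub>m^k\<^sub>m\<close>.
\<close>

lemma canonical_LND_exists:
  fixes k :: "'n::finite \<Rightarrow> nat" and s :: "nat \<Rightarrow> ('n \<Rightarrow>\<^sub>0 nat) \<Rightarrow>\<^sub>0 'k::field_char_0"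
  shows "\<exists>D. canonical_LND k d s D"
proof -
  define X where "X = danielewski k d s"
  define M where "M p = (\<Prod>i\<in>UNIV. p (Cy i) ^ k i)" for p :: "'n coord \<Rightarrow> 'k"
  define Q where "Q p = dan_poly d s (\<lambda>i. p (Cy i))" for p :: "'n coord \<Rightarrow> 'k"
  have X: "p \<in> X \<longleftrightarrow> p Cx * M p = poly (Q p) (p Cz)" for p
    by (simp add: X_def danielewski_def M_def Q_def)
  have "\<exists>q. poly q 0 = p Cx \<and> poly (pderiv q) 0 = poly (pderiv (Q p)) (p Cz) \<and>
            smult (M p) q = pcompose (Q p) [:p Cz, M p:]" if "p \<in> X" for p
  proof (cases "M p = 0")
    case True
    then show ?thesis using that
      by (intro exI[of _ "[:p Cx, poly (pderiv (Q p)) (p Cz):]"])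
         (auto simp: X pderiv_pCons pcompose_idR poly_eq_poly_eq_iff[symmetric] poly_pcompose fun_eq_iff)
  next
    case False
    then show ?thesis using that
      by (intro exI[of _ "smult (inverse (M p)) (pcompose (Q p) [:p Cz, M p:])"])
         (auto simp: X pderiv_smult pderiv_pcompose poly_pcompose pderiv_pCons field_simps)
  qed
  then obtain qx where qx: "\<And>p. p \<in> X \<Longrightarrow> poly (qx p) 0 = p Cx"
    "\<And>p. p \<in> X \<Longrightarrow> poly (pderiv (qx p)) 0 = poly (pderiv (Q p)) (p Cz)"
    "\<And>p. p \<in> X \<Longrightarrow> smult (M p) (qx p) = pcompose (Q p) [:p Cz, M p:]"
    by metis
  define c where "c p v = (case v of Cx \<Rightarrow> qx p | Cy i \<Rightarrow> [:p (Cy i):] | Cz \<Rightarrow> [:p Cz, M p:])"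
    for p and v :: "'n coord"
  define C where "C p t = (\<lambda>v. poly (c p v) t)" for p t
  have C0: "C p 0 = p" if "p \<in> X" for p
    using that qx(1) by (auto simp: C_def c_def fun_eq_iff split: coord.splits)
  have CX: "C p t \<in> X" if "p \<in> X" for p t
  proof -
    have "M (C p t) = M p" "Q (C p t) = Q p" by (simp_all add: M_def Q_def C_def c_def)
    then show ?thesis
      using arg_cong[OF qx(3)[OF that], of "\<lambda>q. poly q t"]
      by (simp add: X C_def c_def poly_pcompose mult_ac)
  qed
  define along where "along f p q \<longleftrightarrow> (\<forall>t. f (C p t) = poly q t)" for f p q
  have along_unique: "q = q'" if "along f p q" "along f p q'" for f p q q'
    using that by (auto simp: along_def poly_eq_poly_eq_iff[symmetric] fun_eq_iff)
  define A where "A f p = (THE q. along f p q)" for f p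
  have AI: "A f p = q" if "along f p q" for f p q
    unfolding A_def using that along_unique by blast
  have a_const: "along (\<lambda>p\<in>X. a) p [:a:]" if "p \<in> X" for p a
    using CX[OF that] by (simp add: along_def)
  have a_coord: "along (\<lambda>p\<in>X. p v) p (c p v)" if "p \<in> X" for p v
    using CX[OF that] by (simp add: along_def C_def)
  have a_add: "along (\<lambda>p\<in>X. f p + g p) p (q + r)"
    and a_mult: "along (\<lambda>p\<in>X. f p * g p) p (q * r)"
    if "p \<in> X" "along f p q" "along g p r" for f g p q r
    using CX[OF that(1)] that by (simp_all add: along_def)
  have a_ex: "along f p (A f p)" if "f \<in> regular_functions X" "p \<in> X" for f p
  proof -
    from that(1) have "\<exists>q. along f p q"
      by (induction rule: regular_functions_induct)
         (use a_const a_coord a_add a_mult that(2) in blast)+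
    then show ?thesis using AI by metis
  qed
  have A0: "poly (A f p) 0 = f p" if "f \<in> regular_functions X" "p \<in> X" for f p
    using a_ex[OF that] C0[OF that(2)] by (metis along_def)
  define D where "D f = (\<lambda>p\<in>X. poly (pderiv (A f p)) 0)" for f
  have D_const: "D (\<lambda>p\<in>X. a) = (\<lambda>p\<in>X. 0)" for a
    by (auto simp: D_def AI[OF a_const] intro!: restrict_ext)
  have D_coord: "D (\<lambda>p\<in>X. p v) = (\<lambda>p\<in>X. poly (pderiv (c p v)) 0)" for v
    by (auto simp: D_def AI[OF a_coord] intro!: restrict_ext)
  have D_add: "D (\<lambda>p\<in>X. f p + g p) = (\<lambda>p\<in>X. D f p + D g p)"
    and D_mult: "D (\<lambda>p\<in>X. f p * g p) = (\<lambda>p\<in>X. D f p * g p + f p * D g p)"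
    if "f \<in> regular_functions X" "g \<in> regular_functions X" for f g
    using that
    by (auto simp: D_def AI[OF a_add[OF _ a_ex a_ex]] AI[OF a_mult[OF _ a_ex a_ex]]
        pderiv_add pderiv_mult A0 mult_ac intro!: restrict_ext)
  have D_x: "D (\<lambda>p\<in>X. p Cx) = (\<lambda>p\<in>X. poly (pderiv (Q p)) (p Cz))"
    and D_y: "D (\<lambda>p\<in>X. p (Cy i)) = (\<lambda>p\<in>X. 0)"
    and D_z: "D (\<lambda>p\<in>X. p Cz) = (\<lambda>p\<in>X. M p)" for i
    by (auto simp: D_coord c_def qx pderiv_pCons intro!: restrict_ext)
  have reg_M: "(\<lambda>p\<in>X. M p) \<in> regular_functions X"
    unfolding M_def
    by (intro regular_functions_prod regular_functions_power regular_functions_coord)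
  have pderiv_sum': "pderiv (\<Sum>j<d. q j) = (\<Sum>j<d. pderiv (q j))" for q :: "nat \<Rightarrow> 'k poly"
    by (induction d) (simp_all add: pderiv_add)
  have reg_Q: "(\<lambda>p\<in>X. poly (pderiv (Q p)) (p Cz)) \<in> regular_functions X"
    unfolding Q_def dan_poly_def pderiv_add pderiv_sum' pderiv_monom poly_add poly_sum poly_monom
    by (intro regular_functions_add regular_functions_sum regular_functions_mult
        regular_functions_power regular_functions_const regular_functions_coord
        regular_functions_compose)
  have reg_D: "D f \<in> regular_functions X" if "f \<in> regular_functions X" for f
    using that
  proof (induction rule: regular_functions_induct)
    case (coord v)
    show ?case using reg_M reg_Q
      by (cases v) (simp_all only: D_x D_y D_z regular_functions_const)
  next
    case (add f g)
    then show ?case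
      by (simp only: D_add) (intro regular_functions_add; simp only: regular_functions_restrict)
  next
    case (mult f g)
    then show ?case
      by (simp only: D_mult)
         (intro regular_functions_add regular_functions_mult; simp only: regular_functions_restrict)
  qed (simp only: D_const regular_functions_const)
  have D_scale: "D (\<lambda>p\<in>X. a * f p) = (\<lambda>p\<in>X. a * D f p)" if "f \<in> regular_functions X" for a f
  proof -
    have "(\<lambda>p\<in>X. a * f p) = (\<lambda>p\<in>X. (\<lambda>p\<in>X. a) p * f p)" by (auto intro!: restrict_ext)
    then show ?thesis
      using D_mult[OF regular_functions_const that, of a]
      by (auto simp: D_const intro!: restrict_ext)
  qed
  have "canonical_LND k d s D"
    using D_x D_y D_z D_add D_mult D_scale reg_D
    unfolding canonical_LND_def derivation_def X_def[symmetric] M_def Q_def by (simp add: Let_def)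
  then show ?thesis by blast
qed

end

theory Submission
  imports Defs "HOL-Library.Countable"
begin

text \<open>
  The degree function of the canonical derivation is the degree in \<open>z\<close>: where the \<open>y\<^sub>i\<close> are nonzero,
  \<open>x\<close> can be eliminated, and the derivation becomes \<open>y^k \<partial>/\<partial>z\<close>. The same holds for every
  derivation \<open>h \<partial>/\<partial>z\<close> with \<open>h \<noteq> 0\<close> free of \<open>z\<close> (\<open>vertical_nilpotency\<close>). An automorphism
  conjugates the canonical derivation into another nonzero locally nilpotent derivation \<open>\<delta>\<close>, whose degree
  function is the transported one. So the theorem follows once every nonzero locally nilpotent derivation
  of \<open>\<K>[X]\<close> is known to have this form (\<open>locally_nilpotent_vertical\<close>).

  For this, regular functions are expanded as Laurent polynomials in \<open>z\<close> and the \<open>y\<^sub>i\<close>, with exponents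
  ordered lexicographically and \<open>z\<close> first. Because \<open>P\<close> is monic in \<open>z\<close>, each function has a normal form
  as a combination of the products \<open>x^a z^b\<close>, \<open>b < d\<close>, with polynomials in \<open>y\<close> as coefficients; these
  products have distinct degrees \<open>ad + b\<close> in \<open>z\<close> and leading terms \<open>z^(ad+b) / y^(ak)\<close>. This determines
  the leading exponents that occur in \<open>\<K>[X]\<close> (\<open>expansion_exists\<close>).

  On leading exponents \<open>\<delta>\<close> acts as a translation by a fixed exponent \<open>e\<close>, as long as a linear functional,
  the symbol, does not vanish. Local nilpotency forces the symbol to vanish after finitely many translations
  (\<open>symbol_nilpotent\<close>), so up to a common factor it takes values in the natural numbers on the exponents of
  \<open>x\<close>, \<open>z\<close>, \<open>y\<^sub>i\<close>, and \<open>-1\<close> on \<open>e\<close>. If \<open>e\<close> had a nonnegative component in the direction of \<open>z\<close>, then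
  translation by \<open>e\<close> would lead some \<open>y\<^sub>i\<close> or \<open>z\<close> out of the exponents of \<open>\<K>[X]\<close>; this is where
  \<open>d, k\<^sub>i \<ge> 2\<close> enters (\<open>no_leading_exponent\<close>). So \<open>e\<close> lowers the degree in \<open>z\<close>, and since \<open>e\<close> is the
  largest exponent in \<open>\<delta>\<close>, all of \<open>\<delta>\<close> does. As \<open>\<delta>(y\<^sub>i)\<close> has no negative powers of \<open>z\<close>, it is zero.
\<close>

abbreviation "lookup \<equiv> Poly_Mapping.lookup"
abbreviation "keys \<equiv> Poly_Mapping.keys"
abbreviation "single \<equiv> Poly_Mapping.single"

section \<open>Laurent polynomials with a monomial order\<close>

text \<open>
  The coordinates of the torus on which \<open>z\<close> and all the \<open>y\<^sub>i\<close> are nonzero.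
\<close>

datatype 'n var = VZ | VY 'n

lemma UNIV_var: "UNIV = insert VZ (range VY)"
  by (auto intro: var.exhaust)

instance var :: (finite) finite
  by standard (simp add: UNIV_var)

text \<open>
  Exponents are functions from the variables to the integers, compared lexicographically. Since \<open>z\<close>
  comes first here, the order of exponents refines the order by degree in \<open>z\<close>. The \<open>y\<^sub>i\<close> are put
  in an arbitrary order, which makes the order of exponents linear.
\<close>

instantiation var :: (countable) linorder
begin

definition var_rank :: "'a var \<Rightarrow> nat" where
  "var_rank v = (case v of VZ \<Rightarrow> 0 | VY i \<Rightarrow> Suc (to_nat i))"

definition less_eq_var :: "'a var \<Rightarrow> 'a var \<Rightarrow> bool" where
  "less_eq_var u v \<longleftrightarrow> var_rank u \<le> var_rank v"

definition less_var :: "'a var \<Rightarrow> 'a var \<Rightarrow> bool" where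
  "less_var u v \<longleftrightarrow> var_rank u < var_rank v"

instance
proof
  fix u v :: "'a var"
  show "u = v" if "u \<le> v" "v \<le> u"
    using that by (cases u; cases v) (auto simp: less_eq_var_def var_rank_def)
qed (auto simp: less_eq_var_def less_var_def)

end

lemma VZ_le: "VZ \<le> v"
  by (simp add: less_eq_var_def var_rank_def)

type_synonym 'n expo = "'n var \<Rightarrow>\<^sub>0 int"
type_synonym ('n, 'k) laurent = "'n expo \<Rightarrow>\<^sub>0 'k"

lemma VZ_mono:
  fixes m n :: "'n::finite expo"
  assumes "m \<le> n"
  shows "lookup m VZ \<le> lookup n VZ"
proof -
  have "m = n \<or> less_fun (lookup m) (lookup n)"
    using assms by transfer auto
  moreover have "lookup m VZ \<le> lookup n VZ" if "less_fun (lookup m) (lookup n)"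
    using that VZ_le unfolding less_fun_def by (metis order_le_imp_less_or_eq order_less_imp_le order_refl)
  ultimately show ?thesis by auto
qed

lemma poly_mapping_additive_induct [case_names single add]:
  fixes F :: "'a \<Rightarrow>\<^sub>0 'b::comm_monoid_add"
  assumes "\<And>m a. S (single m a)"
    and "\<And>F G. S F \<Longrightarrow> S G \<Longrightarrow> S (F + G)"
  shows "S F"
proof -
  have "S (\<Sum>m\<in>A. single m (lookup F m))" if "finite A" for A
    using that
  proof induction
    case empty
    show ?case using assms(1)[of undefined 0] by simp
  qed (use assms in auto)
  then show ?thesis by (metis finite_keys poly_mapping_sum_single)
qed

lemma lookup_mult_top:
  fixes C H :: "'a::{ordered_cancel_comm_monoid_add, linorder} \<Rightarrow>\<^sub>0 'b::comm_ring_1"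
  assumes C: "\<And>m. m \<in> keys C \<Longrightarrow> m \<le> e" and H: "\<And>m. m \<in> keys H \<Longrightarrow> m \<le> g"
  shows "lookup (C * H) (e + g) = lookup C e * lookup H g"
proof -
  have eq: "m = e \<and> n = g" if "m \<in> keys C" "n \<in> keys H" "m + n = e + g" for m n
  proof -
    have le: "m \<le> e" "n \<le> g" using that(1,2) C H by blast+
    have "m + g = e + g"
      using add_right_mono[OF le(1), of g] add_left_mono[OF le(2), of m] that(3) by (intro antisym) auto
    then have "m = e" by simp
    then show ?thesis using that(3) by simp
  qed
  have "C * H = (\<Sum>m\<in>keys C. \<Sum>n\<in>keys H. single (m + n) (lookup C m * lookup H n))"
    by (subst (1) poly_mapping_sum_single[of C], subst (1) poly_mapping_sum_single[of H])
       (simp add: sum_product mult_single)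
  then have "lookup (C * H) (e + g) =
      (\<Sum>m\<in>keys C. \<Sum>n\<in>keys H. if m = e \<and> n = g then lookup C m * lookup H n else 0)"
    using eq by (auto simp: lookup_sum lookup_single when_def intro!: sum.cong)
  also have "\<dots> = (\<Sum>m\<in>keys C. if m = e then \<Sum>n\<in>keys H. if n = g then lookup C m * lookup H n else 0 else 0)"
    by (intro sum.cong) auto
  also have "\<dots> = lookup C e * lookup H g"
    by (auto simp: in_keys_iff)
  finally show ?thesis .
qed

lemma keys_mult_le:
  fixes C H :: "'a::{ordered_cancel_comm_monoid_add, linorder} \<Rightarrow>\<^sub>0 'b::comm_ring_1"
  assumes "\<And>m. m \<in> keys C \<Longrightarrow> m \<le> e" "\<And>m. m \<in> keys H \<Longrightarrow> m \<le> g" "l \<in> keys (C * H)"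
  shows "l \<le> e + g"
  using keys_mult[of C H] assms by (fastforce intro: add_mono)

lemma lookup_const_mult:
  fixes F :: "'a::comm_monoid_add \<Rightarrow>\<^sub>0 'b::comm_ring_1"
  shows "lookup (single 0 a * F) m = a * lookup F m"
  by (induction F rule: poly_mapping_additive_induct)
     (simp_all add: mult_single lookup_single when_def lookup_add algebra_simps)

section \<open>Evaluation on the torus\<close>

definition character :: "('n::finite var \<Rightarrow> 'k::field) \<Rightarrow> 'n expo \<Rightarrow> 'k" where
  "character c m = (\<Prod>v\<in>UNIV. c v powi lookup m v)"

lemma character_0 [simp]: "character c 0 = 1"
  by (simp add: character_def)

lemma character_add:
  assumes "\<And>v. c v \<noteq> 0"
  shows "character c (m + n) = character c m * character c n"
  using assms by (simp add: character_def lookup_add power_int_add prod.distrib)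

lemma character_mult: "character (\<lambda>v. c v * c' v) m = character c m * character c' m"
  by (simp add: character_def power_int_mult_distrib prod.distrib)

lemma character_single: "character c (single v n) = c v powi n"
proof -
  have "character c (single v n) = (\<Prod>w\<in>UNIV. if w = v then c v powi n else 1)"
    unfolding character_def by (intro prod.cong) (auto simp: lookup_single when_def)
  then show ?thesis by simp
qed

lemma inj_powi_two: "inj (\<lambda>j :: int. (2 :: 'k::field_char_0) powi j)"
proof -
  have less: "(2 :: 'k) powi i \<noteq> 2 powi j" if "i < j" for i j
  proof
    assume eq: "(2 :: 'k) powi i = 2 powi j"
    define n where "n = nat (j - i)"
    have n: "n > 0" "j = i + int n" using that by (auto simp: n_def)
    have "(2 :: 'k) ^ n = 1"
      using eq by (simp add: n(2) power_int_add)
    then have "of_nat (2 ^ n) = (of_nat 1 :: 'k)" by simp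
    then have "(2::nat) ^ n = 1" by (simp only: of_nat_eq_iff)
    then show False using n(1) by simp
  qed
  show ?thesis
    by (rule linorder_injI) (rule less)
qed

text \<open>
  All coordinates of the separating point are \<open>1\<close> except for a \<open>2\<close> at a variable where the exponents
  differ; \<open>2\<close> is not a root of unity in characteristic zero.
\<close>

lemma characters_separate:
  fixes m n :: "'n::finite expo"
  assumes "m \<noteq> n"
  shows "\<exists>c :: 'n var \<Rightarrow> 'k::field_char_0. (\<forall>v. c v \<noteq> 0) \<and> character c m \<noteq> character c n"
proof -
  obtain v where v: "lookup m v \<noteq> lookup n v"
    using assms by (metis poly_mapping_eqI)
  define c :: "'n var \<Rightarrow> 'k" where "c w = (if w = v then 2 else 1)" for w
  have c: "character c l = 2 powi lookup l v" for l
  proof -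
    have "character c l = (\<Prod>w\<in>UNIV. if w = v then 2 powi lookup l v else 1)"
      unfolding character_def c_def by (intro prod.cong) auto
    then show ?thesis by simp
  qed
  have "(2::'k) powi lookup m v \<noteq> 2 powi lookup n v"
    using v by (simp add: inj_eq[OF inj_powi_two])
  then show ?thesis by (intro exI[of _ c]) (auto simp: c c_def split: if_splits)
qed

definition laurent_eval :: "('n::finite var \<Rightarrow> 'k::field) \<Rightarrow> ('n, 'k) laurent \<Rightarrow> 'k" where
  "laurent_eval c F = (\<Sum>m\<in>keys F. lookup F m * character c m)"

lemma laurent_eval_superset:
  assumes "finite A" "keys F \<subseteq> A"
  shows "laurent_eval c F = (\<Sum>m\<in>A. lookup F m * character c m)"
  unfolding laurent_eval_def by (rule sum.mono_neutral_left) (use assms in \<open>auto simp: in_keys_iff\<close>)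

lemma laurent_eval_add [simp]: "laurent_eval c (F + G) = laurent_eval c F + laurent_eval c G"
proof -
  let ?A = "keys F \<union> keys G"
  have "finite ?A" "keys F \<subseteq> ?A" "keys G \<subseteq> ?A" "keys (F + G) \<subseteq> ?A"
    using Poly_Mapping.keys_add[of F G] by auto
  then show ?thesis
    by (simp add: laurent_eval_superset[of ?A] lookup_add distrib_right sum.distrib)
qed

lemma laurent_eval_0 [simp]: "laurent_eval c 0 = 0"
  by (simp add: laurent_eval_def)

lemma laurent_eval_sum [simp]: "laurent_eval c (sum F I) = (\<Sum>i\<in>I. laurent_eval c (F i))"
  by (induction I rule: infinite_finite_induct) simp_all

lemma laurent_eval_single [simp]: "laurent_eval c (single m a) = a * character c m"
  by (subst laurent_eval_superset[of "{m}"]) auto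

lemma laurent_eval_mult:
  assumes "\<And>v. c v \<noteq> 0"
  shows "laurent_eval c (F * G) = laurent_eval c F * laurent_eval c G"
proof (induction F rule: poly_mapping_additive_induct)
  case (single m a)
  show ?case
    by (induction G rule: poly_mapping_additive_induct)
       (simp_all add: mult_single character_add assms algebra_simps)
qed (simp add: algebra_simps)

text \<open>
  Dedekind's independence of characters. It makes a Laurent polynomial determined by its values on
  the torus.
\<close>

lemma characters_independent:
  fixes a :: "'n::finite expo \<Rightarrow> 'k::field_char_0"
  assumes "finite A" "\<And>c :: 'n var \<Rightarrow> 'k. (\<And>v. c v \<noteq> 0) \<Longrightarrow> (\<Sum>m\<in>A. a m * character c m) = 0"
  shows "\<forall>m\<in>A. a m = 0"
  using assms
proof (induction A arbitrary: a)
  case empty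
  then show ?case by simp
next
  case (insert m0 A)
  have zero: "a m = 0" if m: "m \<in> A" for m
  proof -
    have "m \<noteq> m0" using m insert by auto
    then obtain t :: "'n var \<Rightarrow> 'k" where t: "\<And>v. t v \<noteq> 0" "character t m \<noteq> character t m0"
      using characters_separate[of m m0] by blast
    \<comment> \<open>translating the relation by \<open>t\<close> and subtracting \<open>character t m0\<close> times the relation itself
      eliminates \<open>m0\<close>\<close>
    have "\<forall>m\<in>A. a m * (character t m - character t m0) = 0"
    proof (rule insert.IH)
      fix c :: "'n var \<Rightarrow> 'k" assume c: "\<And>v. c v \<noteq> 0"
      have "(\<Sum>m\<in>A. a m * (character t m - character t m0) * character c m) =
            (\<Sum>m\<in>insert m0 A. a m * (character t m - character t m0) * character c m)"
        using insert by simp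
      also have "\<dots> = (\<Sum>m\<in>insert m0 A. a m * character (\<lambda>v. t v * c v) m) -
                      character t m0 * (\<Sum>m\<in>insert m0 A. a m * character c m)"
        unfolding character_mult sum_distrib_left sum_subtractf[symmetric]
        by (intro sum.cong) (auto simp: algebra_simps)
      also have "\<dots> = 0"
        using insert.prems[of c] insert.prems[of "\<lambda>v. t v * c v"] c t(1) by simp
      finally show "(\<Sum>m\<in>A. a m * (character t m - character t m0) * character c m) = 0" .
    qed
    then show ?thesis using m t(2) by auto
  qed
  have "a m0 * character (\<lambda>v. 1) m0 = 0"
    using insert.prems[of "\<lambda>v. 1"] insert.hyps zero by simp
  then have "a m0 = 0" by (simp add: character_def)
  then show ?case using zero by auto
qed

lemma laurent_eqI:
  fixes F G :: "('n::finite, 'k::field_char_0) laurent"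
  assumes "\<And>c. (\<And>v. c v \<noteq> 0) \<Longrightarrow> laurent_eval c F = laurent_eval c G"
  shows "F = G"
proof -
  let ?A = "keys F \<union> keys G"
  have "\<forall>m\<in>?A. lookup F m - lookup G m = 0"
  proof (rule characters_independent)
    fix c :: "'n var \<Rightarrow> 'k" assume "\<And>v. c v \<noteq> 0"
    then have "laurent_eval c F = laurent_eval c G" by (rule assms)
    then show "(\<Sum>m\<in>?A. (lookup F m - lookup G m) * character c m) = 0"
      by (simp add: laurent_eval_superset[of ?A] left_diff_distrib sum_subtractf)
  qed simp
  then show ?thesis
    by (intro poly_mapping_eqI) (metis UnCI eq_iff_diff_eq_0 in_keys_iff)
qed

section \<open>Euler derivations\<close>

text \<open>
  The derivation \<open>v \<partial>/\<partial>v\<close>, which is diagonal on monomials.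
\<close>

definition euler :: "'n var \<Rightarrow> ('n::finite, 'k::comm_ring_1) laurent \<Rightarrow> ('n, 'k) laurent" where
  "euler v F = Poly_Mapping.mapp (\<lambda>m a. of_int (lookup m v) * a) F"

lemma lookup_euler: "lookup (euler v F) m = of_int (lookup m v) * lookup F m"
  by (simp add: euler_def lookup_mapp when_def in_keys_iff)

lemma keys_euler: "keys (euler v F) \<subseteq> keys F"
  by (auto simp: in_keys_iff lookup_euler)

lemma euler_add: "euler v (F + G) = euler v F + euler v G"
  by (rule poly_mapping_eqI) (simp add: lookup_euler lookup_add algebra_simps)

lemma euler_single: "euler v (single m a) = single m (of_int (lookup m v) * a)"
  by (rule poly_mapping_eqI) (simp add: lookup_euler lookup_single when_def)

lemma euler_mult: "euler v (F * G) = euler v F * G + F * euler v G"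
proof (induction F rule: poly_mapping_additive_induct)
  case (single m a)
  show ?case
    by (induction G rule: poly_mapping_additive_induct)
       (simp_all add: mult_single euler_single euler_add lookup_add algebra_simps single_add[symmetric])
qed (simp add: euler_add algebra_simps)

text \<open>
  The derivation with \<open>v \<mapsto> C v * v\<close>; every derivation of the Laurent polynomials has this form.
  Writing it through the Euler derivations shows its effect on exponents: each exponent of some
  \<open>C v\<close> contributes a translation with a factor depending linearly on the exponent it is applied to.
\<close>

definition torus_derivation ::
  "('n var \<Rightarrow> ('n::finite, 'k::comm_ring_1) laurent) \<Rightarrow> ('n, 'k) laurent \<Rightarrow> ('n, 'k) laurent" where
  "torus_derivation C F = (\<Sum>v\<in>UNIV. C v * euler v F)"

lemma torus_derivation_add:
  "torus_derivation C (F + G) = torus_derivation C F + torus_derivation C G"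
  by (simp add: torus_derivation_def euler_add distrib_left sum.distrib)

lemma torus_derivation_mult:
  "torus_derivation C (F * G) = torus_derivation C F * G + F * torus_derivation C G"
  by (simp add: torus_derivation_def euler_mult algebra_simps sum.distrib sum_distrib_left)

lemma torus_derivation_const: "torus_derivation C (single 0 a) = 0"
  by (simp add: torus_derivation_def euler_single)

lemma torus_derivation_coord:
  "torus_derivation C (single (single v 1) 1) = C v * single (single v 1) 1"
proof -
  have "torus_derivation C (single (single v 1) 1) =
      (\<Sum>w\<in>UNIV. if w = v then C v * single (single v 1) 1 else 0)"
    unfolding torus_derivation_def
    by (intro sum.cong) (auto simp: euler_single lookup_single when_def)
  then show ?thesis by simp
qed

section \<open>Leading exponents of a derivation\<close>

definition lead :: "('n::finite, 'k::zero) laurent \<Rightarrow> 'n expo" where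
  "lead F = Max (keys F)"

lemma lead_in_keys: "F \<noteq> 0 \<Longrightarrow> lead F \<in> keys F"
  unfolding lead_def by (intro Max_in) auto

lemma lead_ge: "m \<in> keys F \<Longrightarrow> m \<le> lead F"
  unfolding lead_def by (intro Max_ge) auto

lemma lead_eqI: "m \<in> keys F \<Longrightarrow> (\<And>n. n \<in> keys F \<Longrightarrow> n \<le> m) \<Longrightarrow> lead F = m"
  unfolding lead_def by (intro Max_eqI) auto

text \<open>
  If \<open>e\<close> is the largest exponent in the coefficients \<open>C\<close>, the leading part of the derivation sends the
  monomial with exponent \<open>m\<close> to \<open>symbol C e m\<close> times the one with exponent \<open>e + m\<close>.
\<close>

definition symbol :: "('n var \<Rightarrow> ('n::finite, 'k::comm_ring_1) laurent) \<Rightarrow> 'n expo \<Rightarrow> 'n expo \<Rightarrow> 'k" where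
  "symbol C e m = (\<Sum>v\<in>UNIV. lookup (C v) e * of_int (lookup m v))"

lemma symbol_add: "symbol C e (m + n) = symbol C e m + symbol C e n"
  by (simp add: symbol_def lookup_add algebra_simps sum.distrib)

lemma symbol_single: "symbol C e (single v 1) = lookup (C v) e"
proof -
  have "symbol C e (single v 1) = (\<Sum>w\<in>UNIV. if w = v then lookup (C v) e else 0)"
    unfolding symbol_def by (intro sum.cong) (auto simp: lookup_single when_def)
  then show ?thesis by simp
qed

lemma lead_torus_derivation:
  fixes C :: "'n var \<Rightarrow> ('n::finite, 'k::field_char_0) laurent"
  assumes e: "\<And>v m. m \<in> keys (C v) \<Longrightarrow> m \<le> e" and F: "F \<noteq> 0"
    and s: "symbol C e (lead F) \<noteq> 0"
  shows "torus_derivation C F \<noteq> 0" "lead (torus_derivation C F) = e + lead F"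
proof -
  have le: "m \<le> lead F" if "m \<in> keys (euler v F)" for m v
    using subsetD[OF keys_euler that] by (rule lead_ge)
  have "lookup (torus_derivation C F) (e + lead F) = symbol C e (lead F) * lookup F (lead F)"
    by (simp add: torus_derivation_def lookup_sum lookup_mult_top[OF e le] symbol_def
        lookup_euler sum_distrib_left mult_ac)
  then have top: "e + lead F \<in> keys (torus_derivation C F)"
    using s lead_in_keys[OF F] by (simp add: in_keys_iff)
  then show "torus_derivation C F \<noteq> 0" by (metis empty_iff keys_zero)
  show "lead (torus_derivation C F) = e + lead F"
  proof (rule lead_eqI[OF top])
    fix n assume "n \<in> keys (torus_derivation C F)"
    then have "(\<Sum>v\<in>UNIV. lookup (C v * euler v F) n) \<noteq> 0"
      unfolding torus_derivation_def in_keys_iff lookup_sum .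
    then have "\<exists>v. lookup (C v * euler v F) n \<noteq> 0"
      using sum.neutral[of UNIV "\<lambda>v. lookup (C v * euler v F) n"] by blast
    then obtain v where "n \<in> keys (C v * euler v F)" unfolding in_keys_iff ..
    from keys_mult_le[OF e le this] show "n \<le> e + lead F" .
  qed
qed

text \<open>
  As long as the symbol does not vanish at the current leading exponent, that exponent moves by \<open>e\<close>
  and the symbol grows by \<open>symbol C e e\<close>. A nilpotent orbit has to stop, so the symbol vanishes
  after finitely many of these steps.
\<close>

lemma symbol_nilpotent:
  fixes C :: "'n var \<Rightarrow> ('n::finite, 'k::field_char_0) laurent"
  assumes e: "\<And>v m. m \<in> keys (C v) \<Longrightarrow> m \<le> e" and F: "F \<noteq> 0"
    and nil: "(torus_derivation C ^^ l) F = 0"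
  shows "\<exists>n. symbol C e (lead F) = of_nat n * - symbol C e e"
proof (rule ccontr)
  assume non: "\<not> ?thesis"
  have "(torus_derivation C ^^ n) F \<noteq> 0 \<and>
      symbol C e (lead ((torus_derivation C ^^ n) F)) = symbol C e (lead F) + of_nat n * symbol C e e" for n
  proof (induction n)
    case (Suc n)
    have "symbol C e (lead F) + of_nat n * symbol C e e \<noteq> 0"
      using non by (metis add_eq_0_iff2 mult_minus_right)
    then have "symbol C e (lead ((torus_derivation C ^^ n) F)) \<noteq> 0" using Suc by simp
    from lead_torus_derivation[OF e _ this] Suc
    show ?case by (simp add: symbol_add algebra_simps)
  qed (use F in simp)
  then show False using nil by blast
qed

section \<open>Derivations in the direction of z\<close>

text \<open>
  The falling factorial \<open>a (a - 1) \<dots> (a - n + 1)\<close>.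
\<close>

definition falling :: "nat \<Rightarrow> int \<Rightarrow> 'k::comm_ring_1" where
  "falling n a = (\<Prod>j<n. of_int a - of_nat j)"

text \<open>
  The operator \<open>z^n (\<partial>/\<partial>z)^n\<close>.
\<close>

definition falling_euler :: "nat \<Rightarrow> ('n::finite, 'k::comm_ring_1) laurent \<Rightarrow> ('n, 'k) laurent" where
  "falling_euler n F = Poly_Mapping.mapp (\<lambda>m a. falling n (lookup m VZ) * a) F"

lemma lookup_falling_euler: "lookup (falling_euler n F) m = falling n (lookup m VZ) * lookup F m"
  by (simp add: falling_euler_def lookup_mapp when_def in_keys_iff)

lemma falling_eq_0_iff:
  assumes "a \<ge> 0"
  shows "(falling n a :: 'k::field_char_0) = 0 \<longleftrightarrow> a < int n"
proof -
  have j: "(of_int a - of_nat j :: 'k) = 0 \<longleftrightarrow> a = int j" for j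
  proof -
    have "(of_int a - of_nat j :: 'k) = of_int (a - int j)" by simp
    then show ?thesis by (simp only: of_int_eq_0_iff) simp
  qed
  have "(falling n a :: 'k) = 0 \<longleftrightarrow> (\<exists>j\<in>{..<n}. (of_int a - of_nat j :: 'k) = 0)"
    by (simp add: falling_def)
  also have "\<dots> \<longleftrightarrow> a < int n"
    unfolding j using assms by (auto intro!: bexI[of _ "nat a"])
  finally show ?thesis .
qed

text \<open>
  Such a derivation is \<open>h \<partial>/\<partial>z\<close> with \<open>h = z * C VZ\<close> free of \<open>z\<close>. As \<open>h\<close> is a constant for it, its powers
  are \<open>h^n (\<partial>/\<partial>z)^n\<close>.
\<close>

lemma vertical_derivation_power:
  fixes C :: "'n var \<Rightarrow> ('n::finite, 'k::field_char_0) laurent"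
  assumes Y: "\<And>i. C (VY i) = 0" and Z: "\<And>m. m \<in> keys (C VZ) \<Longrightarrow> lookup m VZ = -1"
  shows "(torus_derivation C ^^ n) F = C VZ ^ n * falling_euler n F"
proof -
  have T: "torus_derivation C F = C VZ * euler VZ F" for F
    using Y by (simp add: torus_derivation_def UNIV_var sum.insert_if sum.reindex inj_def image_iff)
  have CZ: "euler VZ (C VZ) = - C VZ"
  proof (rule poly_mapping_eqI)
    fix m
    show "lookup (euler VZ (C VZ)) m = lookup (- C VZ) m"
      by (cases "m \<in> keys (C VZ)") (simp_all add: Z lookup_euler in_keys_iff)
  qed
  have pow: "euler VZ (C VZ ^ n) = - of_nat n * C VZ ^ n" for n
  proof (induction n)
    case 0
    show ?case using euler_single[of VZ 0 1] by simp
  next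
    case (Suc n)
    then show ?case by (simp add: euler_mult CZ algebra_simps)
  qed
  show ?thesis
  proof (induction n)
    case 0
    show ?case by (simp add: poly_mapping_eq_iff fun_eq_iff lookup_falling_euler falling_def)
  next
    case (Suc n)
    have "euler VZ (falling_euler n F) - of_nat n * falling_euler n F = falling_euler (Suc n) F"
    proof (rule poly_mapping_eqI)
      fix m
      have "of_nat n * falling_euler n F = single 0 (of_nat n) * falling_euler n F" by simp
      also have "lookup \<dots> m = of_nat n * lookup (falling_euler n F) m"
        by (rule lookup_const_mult)
      finally show "lookup (euler VZ (falling_euler n F) - of_nat n * falling_euler n F) m =
          lookup (falling_euler (Suc n) F) m"
        by (simp add: lookup_minus lookup_euler lookup_falling_euler falling_def algebra_simps)
    qed
    note step = this
    have "(torus_derivation C ^^ Suc n) F = torus_derivation C (C VZ ^ n * falling_euler n F)"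
      by (simp add: Suc)
    also have "\<dots> = C VZ ^ Suc n * (euler VZ (falling_euler n F) - of_nat n * falling_euler n F)"
      unfolding T euler_mult pow by (simp add: algebra_simps)
    finally show ?case unfolding step .
  qed
qed

text \<open>
  The answer does not involve \<open>C\<close>: all derivations in the direction of \<open>z\<close> define the same degree
  function, namely the degree in \<open>z\<close>.
\<close>

lemma vertical_derivation_nilpotency:
  fixes C :: "'n var \<Rightarrow> ('n::finite, 'k::field_char_0) laurent"
  assumes Y: "\<And>i. C (VY i) = 0" and Z: "\<And>m. m \<in> keys (C VZ) \<Longrightarrow> lookup m VZ = -1"
    and nz: "C VZ \<noteq> 0" and F: "\<And>m. m \<in> keys F \<Longrightarrow> lookup m VZ \<ge> 0"
  shows "(torus_derivation C ^^ n) F = 0 \<longleftrightarrow> (\<forall>m\<in>keys F. lookup m VZ < int n)"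
proof -
  have "(torus_derivation C ^^ n) F = 0 \<longleftrightarrow> falling_euler n F = 0"
    using nz by (simp add: vertical_derivation_power[of C, OF Y Z])
  also have "\<dots> \<longleftrightarrow> (\<forall>m. falling n (lookup m VZ) * lookup F m = 0)"
    by (simp add: poly_mapping_eq_iff fun_eq_iff lookup_falling_euler)
  also have "\<dots> \<longleftrightarrow> (\<forall>m\<in>keys F. (falling n (lookup m VZ) :: 'k) = 0)"
    by (auto simp: in_keys_iff)
  also have "\<dots> \<longleftrightarrow> (\<forall>m\<in>keys F. lookup m VZ < int n)"
    using F falling_eq_0_iff by blast
  finally show ?thesis .
qed

section \<open>Polynomials in y and bounded degree in z\<close>

definition exponent :: "('n::finite var \<Rightarrow> int) \<Rightarrow> 'n expo" where
  "exponent f = Abs_poly_mapping f"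

lemma lookup_exponent [simp]: "lookup (exponent f) v = f v"
  by (simp add: exponent_def)

definition y_exponent :: "('n::finite \<Rightarrow>\<^sub>0 nat) \<Rightarrow> 'n expo" where
  "y_exponent m = exponent (\<lambda>v. case v of VZ \<Rightarrow> 0 | VY i \<Rightarrow> int (lookup m i))"

lemma lookup_y_exponent [simp]:
  "lookup (y_exponent m) VZ = 0" "lookup (y_exponent m) (VY i) = int (lookup m i)"
  by (simp_all add: y_exponent_def)

lemma inj_y_exponent: "y_exponent m = y_exponent n \<longleftrightarrow> m = n"
  by (metis lookup_y_exponent(2) of_nat_eq_iff poly_mapping_eqI)

lemma character_y_exponent:
  "character c (y_exponent m) = (\<Prod>i\<in>keys m. c (VY i) ^ lookup m i)"
proof -
  have "character c (y_exponent m) = (\<Prod>i\<in>UNIV. c (VY i) ^ lookup m i)"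
    by (simp add: character_def UNIV_var prod.insert_if prod.reindex inj_def image_iff)
  also have "\<dots> = (\<Prod>i\<in>keys m. c (VY i) ^ lookup m i)"
    by (rule prod.mono_neutral_right) (auto simp: in_keys_iff)
  finally show ?thesis .
qed

definition y_laurent :: "(('n::finite \<Rightarrow>\<^sub>0 nat) \<Rightarrow>\<^sub>0 'k::comm_ring_1) \<Rightarrow> ('n, 'k) laurent" where
  "y_laurent q = (\<Sum>m\<in>keys q. single (y_exponent m) (lookup q m))"

lemma laurent_eval_y_laurent: "laurent_eval c (y_laurent q) = mpoly_eval q (\<lambda>i. c (VY i))"
  by (simp add: y_laurent_def mpoly_eval_def character_y_exponent)

lemma lookup_y_laurent: "lookup (y_laurent q) (y_exponent m) = lookup q m"
proof -
  have "lookup (y_laurent q) (y_exponent m) = (\<Sum>m'\<in>keys q. if m' = m then lookup q m else 0)"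
    unfolding y_laurent_def lookup_sum
    by (intro sum.cong) (auto simp: lookup_single when_def inj_y_exponent)
  then show ?thesis by (simp add: in_keys_iff)
qed

lemma y_laurent_eq_0_iff: "y_laurent q = 0 \<longleftrightarrow> q = 0"
proof
  assume "y_laurent q = 0"
  then show "q = 0" by (intro poly_mapping_eqI) (metis lookup_y_laurent lookup_zero)
qed (simp add: y_laurent_def)

lemma keys_y_laurent: "m \<in> keys (y_laurent q) \<Longrightarrow> \<exists>n. m = y_exponent n"
proof -
  assume "m \<in> keys (y_laurent q)"
  then have "(\<Sum>n\<in>keys q. lookup (single (y_exponent n) (lookup q n)) m) \<noteq> 0"
    by (simp add: y_laurent_def lookup_sum in_keys_iff)
  then have "\<exists>n. lookup (single (y_exponent n) (lookup q n)) m \<noteq> 0"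
    using sum.neutral[of "keys q" "\<lambda>n. lookup (single (y_exponent n) (lookup q n)) m"] by blast
  then show ?thesis by (metis lookup_single_not_eq)
qed

text \<open>
  Polynomials in \<open>z\<close> of degree less than \<open>n\<close>, with Laurent polynomials in \<open>y\<close> as coefficients.
\<close>

definition z_bounded :: "nat \<Rightarrow> ('n::finite, 'k::zero) laurent set" where
  "z_bounded n = {F. \<forall>m\<in>keys F. 0 \<le> lookup m VZ \<and> lookup m VZ < int n}"

lemma z_bounded_0 [simp]: "0 \<in> z_bounded n"
  by (simp add: z_bounded_def)

lemma z_bounded_mono: "F \<in> z_bounded a \<Longrightarrow> a \<le> b \<Longrightarrow> F \<in> z_bounded b"
  by (fastforce simp: z_bounded_def)

lemma z_bounded_add:
  fixes F :: "('n::finite, 'k::comm_ring_1) laurent"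
  shows "F \<in> z_bounded n \<Longrightarrow> G \<in> z_bounded n \<Longrightarrow> F + G \<in> z_bounded n"
  using Poly_Mapping.keys_add[of F G] by (auto simp: z_bounded_def)

lemma z_bounded_sum:
  fixes F :: "'i \<Rightarrow> ('n::finite, 'k::comm_ring_1) laurent"
  assumes "\<And>i. i \<in> I \<Longrightarrow> F i \<in> z_bounded n"
  shows "sum F I \<in> z_bounded n"
  using assms by (induction I rule: infinite_finite_induct) (auto intro: z_bounded_add)

lemma z_bounded_mult:
  fixes F :: "('n::finite, 'k::comm_ring_1) laurent"
  assumes F: "F \<in> z_bounded (Suc a)" and G: "G \<in> z_bounded b"
  shows "F * G \<in> z_bounded (a + b)"
  unfolding z_bounded_def
proof (intro CollectI ballI)
  fix l assume "l \<in> keys (F * G)"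
  then obtain m n where "l = m + n" "m \<in> keys F" "n \<in> keys G"
    using keys_mult[of F G] by blast
  then show "0 \<le> lookup l VZ \<and> lookup l VZ < int (a + b)"
    using F G by (fastforce simp: z_bounded_def lookup_add)
qed

lemma z_bounded_single: "0 \<le> lookup m VZ \<Longrightarrow> lookup m VZ < int n \<Longrightarrow> single m a \<in> z_bounded n"
  by (auto simp: z_bounded_def split: if_splits)

lemma z_bounded_y_laurent: "y_laurent q \<in> z_bounded (Suc 0)"
  using keys_y_laurent by (fastforce simp: z_bounded_def)

text \<open>
  Since the order compares degrees in \<open>z\<close> first, the terms of lower degree do not affect the leading
  exponent.
\<close>

lemma z_bounded_top:
  fixes A R :: "('n::finite, 'k::comm_ring_1) laurent"
  assumes A: "A \<noteq> 0" "\<And>m. m \<in> keys A \<Longrightarrow> lookup m VZ = int n" and R: "R \<in> z_bounded n"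
  shows "A + R \<noteq> 0" "lead (A + R) \<in> keys A"
proof -
  have R0: "lookup R m = 0" if "lookup m VZ = int n" for m
    using R that by (force simp: z_bounded_def in_keys_iff)
  have A_le: "m \<in> keys (A + R)" if "m \<in> keys A" for m
    using that R0 A(2) by (simp add: in_keys_iff lookup_add)
  obtain m where m: "m \<in> keys A" using A(1) by fastforce
  show nz: "A + R \<noteq> 0" using A_le[OF m] by auto
  have "int n \<le> lookup (lead (A + R)) VZ"
    using VZ_mono[OF lead_ge[OF A_le[OF m]]] A(2)[OF m] by simp
  then have "lead (A + R) \<notin> keys R" using R by (force simp: z_bounded_def)
  then show "lead (A + R) \<in> keys A"
    using lead_in_keys[OF nz] Poly_Mapping.keys_add[of A R] by blast
qed

section \<open>Danielewski varieties\<close>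

locale danielewski_variety =
  fixes k :: "'n::finite \<Rightarrow> nat"
    and d :: nat
    and s :: "nat \<Rightarrow> ('n \<Rightarrow>\<^sub>0 nat) \<Rightarrow>\<^sub>0 'k::field_char_0"
  assumes d_ge_2: "d \<ge> 2"
    and k_ge_2: "\<And>i. k i \<ge> 2"
begin

definition X :: "('n coord \<Rightarrow> 'k) set" where
  "X = danielewski k d s"

definition y_of :: "('n coord \<Rightarrow> 'k) \<Rightarrow> 'n \<Rightarrow> 'k" where
  "y_of p i = p (Cy i)"

definition y_monomial :: "('n \<Rightarrow>\<^sub>0 nat) \<Rightarrow>\<^sub>0 'k" where
  "y_monomial = single (Abs_poly_mapping k) 1"

lemma eval_y_monomial: "mpoly_eval y_monomial y = (\<Prod>i\<in>UNIV. y i ^ k i)"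
proof -
  have "mpoly_eval y_monomial y = (\<Prod>i\<in>keys (Abs_poly_mapping k). y i ^ k i)"
    by (simp add: y_monomial_def mpoly_eval_single)
  also have "\<dots> = (\<Prod>i\<in>UNIV. y i ^ k i)"
    by (rule prod.mono_neutral_left) (auto simp: in_keys_iff)
  finally show ?thesis .
qed

lemma X_iff:
  "p \<in> X \<longleftrightarrow> p Cx * mpoly_eval y_monomial (y_of p) =
     p Cz ^ d + (\<Sum>j<d. mpoly_eval (s j) (y_of p) * p Cz ^ j)"
  by (simp add: X_def danielewski_def dan_poly_def eval_y_monomial y_of_def[abs_def] poly_sum poly_monom)

section \<open>The normal form of a regular function\<close>

text \<open>
  \<open>P\<close> is monic in \<open>z\<close>, so \<open>\<K>[X]\<close> is a free module over the polynomials in \<open>x, y\<close> with basis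
  \<open>1, z, \<dots>, z^(d-1)\<close>, and hence a free module over the polynomials in \<open>y\<close> on the products
  \<open>x^a z^b\<close> with \<open>b < d\<close>. On the torus \<open>x\<close> has degree \<open>d\<close> in \<open>z\<close>; the element numbered \<open>l\<close> is the
  one of degree \<open>l\<close>.
\<close>

definition basis :: "nat \<Rightarrow> ('n coord \<Rightarrow> 'k) \<Rightarrow> 'k" where
  "basis l p = p Cx ^ (l div d) * p Cz ^ (l mod d)"

definition has_normal_form :: "(('n coord \<Rightarrow> 'k) \<Rightarrow> 'k) \<Rightarrow> bool" where
  "has_normal_form f \<longleftrightarrow>
     (\<exists>n q. \<forall>p\<in>X. f p = (\<Sum>l<n. mpoly_eval (q l) (y_of p) * basis l p))"

lemma has_normal_form_cong:
  "(\<And>p. p \<in> X \<Longrightarrow> f p = g p) \<Longrightarrow> has_normal_form f \<longleftrightarrow> has_normal_form g"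
  by (simp add: has_normal_form_def)

lemma mpoly_eval_0 [simp]: "mpoly_eval 0 y = 0"
  by (simp add: mpoly_eval_def)

lemma normal_form_term: "has_normal_form (\<lambda>p. mpoly_eval q (y_of p) * basis l p)"
proof -
  have "(\<Sum>j<Suc l. mpoly_eval (if j = l then q else 0) (y_of p) * basis j p) =
      mpoly_eval q (y_of p) * basis l p" for p
    by simp
  then show ?thesis
    unfolding has_normal_form_def by (intro exI[of _ "Suc l"] exI[of _ "\<lambda>j. if j = l then q else 0"]) simp
qed

lemma normal_form_add:
  assumes "has_normal_form f" "has_normal_form g"
  shows "has_normal_form (\<lambda>p. f p + g p)"
proof -
  obtain a q b r where f: "\<And>p. p \<in> X \<Longrightarrow> f p = (\<Sum>l<a. mpoly_eval (q l) (y_of p) * basis l p)"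
    and g: "\<And>p. p \<in> X \<Longrightarrow> g p = (\<Sum>l<b. mpoly_eval (r l) (y_of p) * basis l p)"
    using assms unfolding has_normal_form_def by auto
  have pad: "(\<Sum>l<n. mpoly_eval (t l) (y_of p) * basis l p) =
      (\<Sum>l<a + b. mpoly_eval (if l < n then t l else 0) (y_of p) * basis l p)" if "n \<le> a + b" for n t p
    using that by (intro sum.mono_neutral_cong_left) auto
  have "f p + g p = (\<Sum>l<a + b.
      mpoly_eval ((if l < a then q l else 0) + (if l < b then r l else 0)) (y_of p) * basis l p)"
    if "p \<in> X" for p
    unfolding f[OF that] g[OF that] mpoly_eval_add
    by (subst pad[of a q], simp, subst pad[of b r], simp)
       (simp add: distrib_right sum.distrib)
  then show ?thesis
    unfolding has_normal_form_def
    by (intro exI[of _ "a + b"]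
        exI[of _ "\<lambda>l. (if l < a then q l else 0) + (if l < b then r l else 0)"]) simp
qed

lemma normal_form_0: "has_normal_form (\<lambda>p. 0)"
  using normal_form_term[of 0] by simp

lemma normal_form_sum:
  assumes "\<And>i. i \<in> I \<Longrightarrow> has_normal_form (f i)"
  shows "has_normal_form (\<lambda>p. \<Sum>i\<in>I. f i p)"
  using assms
  by (induction I rule: infinite_finite_induct) (auto intro: normal_form_add normal_form_0)

lemma normal_form_mult_termwise:
  assumes "has_normal_form f"
    and "\<And>q l. has_normal_form (\<lambda>p. h p * (mpoly_eval q (y_of p) * basis l p))"
  shows "has_normal_form (\<lambda>p. h p * f p)"
proof -
  obtain a q where f: "\<And>p. p \<in> X \<Longrightarrow> f p = (\<Sum>l<a. mpoly_eval (q l) (y_of p) * basis l p)"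
    using assms(1) unfolding has_normal_form_def by auto
  have "has_normal_form (\<lambda>p. \<Sum>l<a. h p * (mpoly_eval (q l) (y_of p) * basis l p))"
    by (intro normal_form_sum assms(2))
  then show ?thesis
    by (simp add: f sum_distrib_left cong: has_normal_form_cong)
qed

lemma normal_form_mult_y:
  assumes "has_normal_form f"
  shows "has_normal_form (\<lambda>p. mpoly_eval r (y_of p) * f p)"
proof (rule normal_form_mult_termwise[OF assms])
  fix q l
  show "has_normal_form (\<lambda>p. mpoly_eval r (y_of p) * (mpoly_eval q (y_of p) * basis l p))"
    using normal_form_term[of "r * q" l] by (simp add: mpoly_eval_mult mult.assoc)
qed

lemma normal_form_basis: "has_normal_form (basis l)"
  using normal_form_term[of "single 0 1" l] by (simp add: mpoly_eval_single del: single_one)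

lemma normal_form_mult_x:
  assumes "has_normal_form f"
  shows "has_normal_form (\<lambda>p. p Cx * f p)"
proof (rule normal_form_mult_termwise[OF assms])
  fix q l
  have "basis (l + d) p = p Cx * basis l p" for p
    using d_ge_2 by (simp add: basis_def)
  then show "has_normal_form (\<lambda>p. p Cx * (mpoly_eval q (y_of p) * basis l p))"
    using normal_form_term[of q "l + d"] by (simp add: mult_ac)
qed

text \<open>
  The only case where the product is not again a basis element is \<open>b = d - 1\<close>; there the equation of
  \<open>X\<close> replaces \<open>z^d\<close> by \<open>x y^k - (s\<^bsub>d-1\<^esub> z^(d-1) + \<dots> + s\<^sub>0)\<close>.
\<close>

lemma normal_form_mult_z:
  assumes "has_normal_form f"
  shows "has_normal_form (\<lambda>p. p Cz * f p)"
proof (rule normal_form_mult_termwise[OF assms])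
  fix q l
  have "has_normal_form (\<lambda>p. p Cz * basis l p)"
  proof (cases "Suc (l mod d) < d")
    case True
    then have "basis (Suc l) p = p Cz * basis l p" for p
      by (simp add: basis_def mod_Suc div_Suc)
    then show ?thesis using normal_form_basis[of "Suc l"] by (simp add: has_normal_form_def)
  next
    case False
    then have d: "Suc (l mod d) = d"
      using d_ge_2 by (metis Suc_leI less_le_trans mod_less_divisor not_less_iff_gr_or_eq pos2 leD)
    have z: "p Cz * basis l p = p Cx ^ (l div d) * p Cz ^ d" for p
    proof -
      have "p Cz * basis l p = p Cx ^ (l div d) * p Cz ^ Suc (l mod d)"
        by (simp add: basis_def)
      then show ?thesis by (simp only: d)
    qed
    have j: "basis (l div d * d + j) p = p Cx ^ (l div d) * p Cz ^ j" if "j < d" for j p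
      using that by (simp add: basis_def)
    have x: "basis (Suc (l div d) * d) p = p Cx ^ Suc (l div d)" for p
      using d_ge_2 by (simp only: basis_def) simp
    have *: "has_normal_form (\<lambda>p. mpoly_eval y_monomial (y_of p) * basis (Suc (l div d) * d) p +
        (\<Sum>j<d. mpoly_eval (- s j) (y_of p) * basis (l div d * d + j) p))"
      by (intro normal_form_add normal_form_sum normal_form_term)
    have neg: "mpoly_eval (- s j) y = - mpoly_eval (s j) y" for j y
      using mpoly_eval_add[of "- s j" "s j" y] by (simp add: add_eq_0_iff2)
    have "p Cz * basis l p = mpoly_eval y_monomial (y_of p) * basis (Suc (l div d) * d) p +
        (\<Sum>j<d. mpoly_eval (- s j) (y_of p) * basis (l div d * d + j) p)" if "p \<in> X" for p
    proof -
      have tail: "(\<Sum>j<d. mpoly_eval (- s j) (y_of p) * basis (l div d * d + j) p) =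
          - (p Cx ^ (l div d) * (\<Sum>j<d. mpoly_eval (s j) (y_of p) * p Cz ^ j))"
        unfolding sum_distrib_left sum_negf[symmetric] by (intro sum.cong) (simp_all add: j neg)
      have top: "p Cz ^ d = p Cx * mpoly_eval y_monomial (y_of p) -
          (\<Sum>j<d. mpoly_eval (s j) (y_of p) * p Cz ^ j)"
        using that by (simp add: X_iff)
      show ?thesis unfolding z x tail top by (simp add: algebra_simps)
    qed
    then show ?thesis using * by (simp cong: has_normal_form_cong)
  qed
  from normal_form_mult_y[OF this, of q]
  show "has_normal_form (\<lambda>p. p Cz * (mpoly_eval q (y_of p) * basis l p))"
    by (simp add: mult_ac)
qed

lemma normal_form_regular:
  assumes "f \<in> regular_functions X"
  shows "has_normal_form f"
proof -
  \<comment> \<open>closure of normal forms under multiplication by \<open>f\<close> passes to products of regular functions,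
    so that only the generators have to be considered\<close>
  have "\<forall>g. has_normal_form g \<longrightarrow> has_normal_form (\<lambda>p. f p * g p)"
    using assms
  proof (induction rule: regular_functions_induct)
    case (const c)
    show ?case
    proof (intro allI impI)
      fix g assume "has_normal_form g"
      from normal_form_mult_y[OF this, of "single 0 c"]
      show "has_normal_form (\<lambda>p. (\<lambda>p\<in>X. c) p * g p)"
        by (simp add: mpoly_eval_single cong: has_normal_form_cong)
    qed
  next
    case (coord v)
    show ?case
    proof (intro allI impI)
      fix g assume g: "has_normal_form g"
      have "has_normal_form (\<lambda>p. p v * g p)"
      proof (cases v)
        case (Cy i)
        have "mpoly_eval (single (single i 1) 1) (y_of p) = p (Cy i)" for p
          by (simp add: mpoly_eval_single y_of_def)
        then show ?thesis using normal_form_mult_y[OF g, of "single (single i 1) 1"] Cy by simp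
      qed (use normal_form_mult_x[OF g] normal_form_mult_z[OF g] in auto)
      then show "has_normal_form (\<lambda>p. (\<lambda>p\<in>X. p v) p * g p)"
        by (simp cong: has_normal_form_cong)
    qed
  next
    case (add f1 f2)
    show ?case
    proof (intro allI impI)
      fix g assume "has_normal_form g"
      with add.IH have "has_normal_form (\<lambda>p. f1 p * g p + f2 p * g p)"
        by (intro normal_form_add) auto
      then show "has_normal_form (\<lambda>p. (\<lambda>p\<in>X. f1 p + f2 p) p * g p)"
        by (simp add: distrib_right cong: has_normal_form_cong)
    qed
  next
    case (mult f1 f2)
    show ?case
    proof (intro allI impI)
      fix g assume "has_normal_form g"
      with mult.IH have "has_normal_form (\<lambda>p. f1 p * (f2 p * g p))" by blast
      then show "has_normal_form (\<lambda>p. (\<lambda>p\<in>X. f1 p * f2 p) p * g p)"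
        by (simp add: mult.assoc cong: has_normal_form_cong)
    qed
  qed
  from this[rule_format, OF normal_form_basis[of 0]] show ?thesis
    by (simp add: basis_def)
qed

section \<open>Expansion of regular functions on the torus\<close>

text \<open>
  Where all the \<open>y\<^sub>i\<close> are nonzero, the equation of \<open>X\<close> determines \<open>x\<close>.
\<close>

definition torus_point :: "('n var \<Rightarrow> 'k) \<Rightarrow> 'n coord \<Rightarrow> 'k" where
  "torus_point c = (\<lambda>v. case v of
     Cx \<Rightarrow> (c VZ ^ d + (\<Sum>j<d. mpoly_eval (s j) (\<lambda>i. c (VY i)) * c VZ ^ j)) /
           mpoly_eval y_monomial (\<lambda>i. c (VY i))
   | Cy i \<Rightarrow> c (VY i) | Cz \<Rightarrow> c VZ)"

lemma torus_point_simps [simp]: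
  "torus_point c (Cy i) = c (VY i)" "torus_point c Cz = c VZ" "y_of (torus_point c) = (\<lambda>i. c (VY i))"
  by (simp_all add: torus_point_def y_of_def fun_eq_iff)

lemma torus_point_in_X [simp]:
  assumes "\<And>v. c v \<noteq> 0"
  shows "torus_point c \<in> X"
proof -
  have "mpoly_eval y_monomial (\<lambda>i. c (VY i)) \<noteq> 0"
    using assms by (simp add: eval_y_monomial)
  then show ?thesis by (simp add: X_iff) (simp add: torus_point_def)
qed

definition expands :: "(('n coord \<Rightarrow> 'k) \<Rightarrow> 'k) \<Rightarrow> ('n, 'k) laurent \<Rightarrow> bool" where
  "expands f F \<longleftrightarrow> (\<forall>c. (\<forall>v. c v \<noteq> 0) \<longrightarrow> f (torus_point c) = laurent_eval c F)"

lemma expands_unique: "expands f F \<Longrightarrow> expands f G \<Longrightarrow> F = G"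
  by (rule laurent_eqI) (metis expands_def)

lemma expands_restrict [simp]: "expands (\<lambda>p\<in>X. f p) F \<longleftrightarrow> expands f F"
  by (simp add: expands_def)

lemma expands_const: "expands (\<lambda>p. a) (single 0 a)"
  by (simp add: expands_def)

lemma expands_0: "expands (\<lambda>p. 0) 0"
  by (simp add: expands_def)

lemma expands_add: "expands f F \<Longrightarrow> expands g G \<Longrightarrow> expands (\<lambda>p. f p + g p) (F + G)"
  by (simp add: expands_def)

lemma expands_mult: "expands f F \<Longrightarrow> expands g G \<Longrightarrow> expands (\<lambda>p. f p * g p) (F * G)"
  by (simp add: expands_def laurent_eval_mult)

lemma expands_sum:
  assumes "\<And>i. i \<in> I \<Longrightarrow> expands (f i) (F i)"
  shows "expands (\<lambda>p. \<Sum>i\<in>I. f i p) (\<Sum>i\<in>I. F i)"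
  using assms
  by (induction I rule: infinite_finite_induct) (auto intro: expands_add expands_0)

fun coord_of :: "'n var \<Rightarrow> 'n coord" where
  "coord_of VZ = Cz"
| "coord_of (VY i) = Cy i"

lemma expands_coord: "expands (\<lambda>p. p (coord_of v)) (single (single v 1) 1)"
  by (cases v) (simp_all add: expands_def character_single)

lemma expands_y: "expands (\<lambda>p. mpoly_eval q (y_of p)) (y_laurent q)"
  by (simp add: expands_def laurent_eval_y_laurent)

definition x_exponent :: "'n expo" where
  "x_exponent = exponent (\<lambda>v. case v of VZ \<Rightarrow> int d | VY i \<Rightarrow> - int (k i))"

definition x_tail :: "('n, 'k) laurent" where
  "x_tail = (\<Sum>j<d. y_laurent (s j) *
     single (exponent (\<lambda>v. case v of VZ \<Rightarrow> int j | VY i \<Rightarrow> - int (k i))) 1)"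

lemma expands_x: "expands (\<lambda>p. p Cx) (single x_exponent 1 + x_tail)"
proof -
  have "torus_point c Cx = laurent_eval c (single x_exponent 1 + x_tail)" if c: "\<And>v. c v \<noteq> 0" for c
  proof -
    have chr: "character c (exponent (\<lambda>v. case v of VZ \<Rightarrow> int j | VY i \<Rightarrow> - int (k i))) =
        c VZ ^ j / (\<Prod>i\<in>UNIV. c (VY i) ^ k i)" for j
      by (simp add: character_def UNIV_var prod.insert_if prod.reindex inj_def image_iff
          power_int_minus prod_inversef[symmetric] divide_inverse)
    show ?thesis
      using c by (simp add: torus_point_def x_exponent_def x_tail_def chr laurent_eval_mult laurent_eval_y_laurent
          eval_y_monomial add_divide_distrib sum_divide_distrib)
  qed
  then show ?thesis by (simp add: expands_def)
qed

lemma z_bounded_x_tail: "x_tail \<in> z_bounded d"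
  unfolding x_tail_def
proof (intro z_bounded_sum)
  fix j assume "j \<in> {..<d}"
  then have "single (exponent (\<lambda>v. case v of VZ \<Rightarrow> int j | VY i \<Rightarrow> - int (k i))) (1::'k) \<in> z_bounded d"
    by (intro z_bounded_single) auto
  from z_bounded_mult[OF z_bounded_y_laurent this]
  show "y_laurent (s j) * single (exponent (\<lambda>v. case v of VZ \<Rightarrow> int j | VY i \<Rightarrow> - int (k i))) 1
      \<in> z_bounded d" by simp
qed

definition basis_exponent :: "nat \<Rightarrow> 'n expo" where
  "basis_exponent l = exponent (\<lambda>v. case v of VZ \<Rightarrow> int l | VY i \<Rightarrow> - int (k i * (l div d)))"

text \<open>
  The leading term of \<open>x\<close> is \<open>z^d / y^k\<close>, because \<open>P\<close> has leading term \<open>z^d\<close>; by multiplicativity,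
  \<open>x^a z^b\<close> has the single top term \<open>z^(ad+b) / y^(ak)\<close>.
\<close>

lemma expands_basis:
  "\<exists>R\<in>z_bounded l. expands (basis l) (single (basis_exponent l) 1 + R)"
proof -
  define E where "E a b = exponent (\<lambda>v. case v of VZ \<Rightarrow> int (a * d + b) | VY i \<Rightarrow> - int (k i * a))" for a b
  have x: "\<exists>R\<in>z_bounded (a * d). expands (\<lambda>p. p Cx ^ a) (single (E a 0) 1 + R)" for a
  proof (induction a)
    case 0
    have "E 0 0 = 0" by (rule poly_mapping_eqI) (simp add: E_def split: var.splits)
    then show ?case using expands_const[of 1] by (intro bexI[of _ 0]) simp_all
  next
    case (Suc a)
    then obtain R where R: "R \<in> z_bounded (a * d)" "expands (\<lambda>p. p Cx ^ a) (single (E a 0) 1 + R)"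
      by blast
    have E: "x_exponent + E a 0 = E (Suc a) 0"
      by (rule poly_mapping_eqI) (simp add: E_def x_exponent_def lookup_add algebra_simps split: var.splits)
    have b1: "single x_exponent 1 * R \<in> z_bounded (d + a * d)"
      by (intro z_bounded_mult z_bounded_single R) (simp_all add: x_exponent_def)
    have "single (E a 0) 1 * x_tail \<in> z_bounded (a * d + d)"
      by (intro z_bounded_mult z_bounded_single z_bounded_x_tail) (simp_all add: E_def)
    then have b2: "x_tail * single (E a 0) 1 \<in> z_bounded (d + a * d)"
      by (simp only: mult.commute[of x_tail] add.commute)
    have b3: "x_tail * R \<in> z_bounded (d + a * d)"
      using z_bounded_mult[OF _ R(1), of x_tail d] z_bounded_mono[OF z_bounded_x_tail] by simp
    have "expands (\<lambda>p. p Cx ^ Suc a) ((single x_exponent 1 + x_tail) * (single (E a 0) 1 + R))"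
      using expands_mult[OF expands_x R(2)] by simp
    also have "(single x_exponent 1 + x_tail) * (single (E a 0) 1 + R) =
        single (E (Suc a) 0) 1 + (single x_exponent 1 * R + x_tail * single (E a 0) 1 + x_tail * R)"
      by (simp add: distrib_left distrib_right mult_single E add.assoc add.left_commute)
    finally show ?case
      using z_bounded_add[OF z_bounded_add[OF b1 b2] b3] by (intro bexI) simp_all
  qed
  obtain R where R: "R \<in> z_bounded (l div d * d)"
    "expands (\<lambda>p. p Cx ^ (l div d)) (single (E (l div d) 0) 1 + R)"
    using x by blast
  have z: "expands (\<lambda>p. p Cz ^ (l mod d)) (single (single VZ (int (l mod d))) 1)"
    by (simp add: expands_def character_single)
  have E: "E (l div d) 0 + single VZ (int (l mod d)) = basis_exponent l"
  proof (rule poly_mapping_eqI)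
    fix v
    have "int (l div d * d) + int (l mod d) = int l"
      by (simp only: of_nat_add[symmetric] div_mult_mod_eq)
    then show "lookup (E (l div d) 0 + single VZ (int (l mod d))) v = lookup (basis_exponent l) v"
      by (cases v) (simp_all add: E_def basis_exponent_def lookup_add lookup_single)
  qed
  have "single (single VZ (int (l mod d))) 1 * R \<in> z_bounded (l mod d + l div d * d)"
    by (intro z_bounded_mult z_bounded_single R) simp_all
  then have b: "R * single (single VZ (int (l mod d))) 1 \<in> z_bounded l"
    by (simp only: mult.commute[of R] mod_div_mult_eq)
  have "expands (basis l) ((single (E (l div d) 0) 1 + R) * single (single VZ (int (l mod d))) 1)"
    using expands_mult[OF R(2) z] by (simp add: basis_def[abs_def])
  also have "(single (E (l div d) 0) 1 + R) * single (single VZ (int (l mod d))) 1 =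
      single (basis_exponent l) 1 + R * single (single VZ (int (l mod d))) 1"
    by (simp add: distrib_right mult_single E)
  finally show ?thesis using b by blast
qed

text \<open>
  The leading exponents of elements of \<open>\<K>[X]\<close>. A function whose degree in \<open>z\<close> is \<open>l\<close> has poles only
  through the factors \<open>x\<close>, and at most \<open>l div d\<close> of them fit into degree \<open>l\<close>.
\<close>

definition admissible :: "'n expo \<Rightarrow> bool" where
  "admissible m \<longleftrightarrow>
     (\<exists>l. lookup m VZ = int l \<and> (\<forall>i. lookup m (VY i) \<ge> - int (k i * (l div d))))"

text \<open>
  The basis elements have distinct degrees in \<open>z\<close>, so the last nonzero term of the normal form
  dominates: the leading exponent is an exponent of its coefficient, which is a polynomial in \<open>y\<close>,
  translated by the exponent of the basis element. In particular the expansion of a function that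
  is not zero on \<open>X\<close> is not zero, although the torus is only a part of \<open>X\<close>.
\<close>

lemma expansion_exists:
  assumes f: "f \<in> regular_functions X"
  shows "\<exists>F. expands f F \<and> (\<forall>m\<in>keys F. lookup m VZ \<ge> 0) \<and>
    (f \<noteq> (\<lambda>p\<in>X. 0) \<longrightarrow> F \<noteq> 0 \<and> admissible (lead F))"
proof -
  obtain n q where nq: "\<And>p. p \<in> X \<Longrightarrow> f p = (\<Sum>l<n. mpoly_eval (q l) (y_of p) * basis l p)"
    using normal_form_regular[OF f] unfolding has_normal_form_def by auto
  obtain R where R: "\<And>l. R l \<in> z_bounded l"
    "\<And>l. expands (basis l) (single (basis_exponent l) 1 + R l)"
    using expands_basis by metis
  define T where "T l = y_laurent (q l) * (single (basis_exponent l) 1 + R l)" for l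
  have T: "T l \<in> z_bounded (Suc l)" for l
  proof -
    have "single (basis_exponent l) 1 + R l \<in> z_bounded (Suc l)"
      using z_bounded_mono[OF R(1)[of l], of "Suc l"]
      by (intro z_bounded_add z_bounded_single) (auto simp: basis_exponent_def)
    from z_bounded_mult[OF z_bounded_y_laurent this] show ?thesis by (simp add: T_def)
  qed
  have "expands (\<lambda>p. \<Sum>l<n. mpoly_eval (q l) (y_of p) * basis l p) (sum T {..<n})"
    unfolding T_def by (intro expands_sum expands_mult expands_y R)
  then have exp: "expands f (sum T {..<n})"
    using nq by (simp add: expands_def)
  moreover have "sum T {..<n} \<in> z_bounded n"
    by (intro z_bounded_sum) (auto intro: z_bounded_mono[OF T])
  then have "\<forall>m\<in>keys (sum T {..<n}). lookup m VZ \<ge> 0" by (simp add: z_bounded_def)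
  moreover have "sum T {..<n} \<noteq> 0 \<and> admissible (lead (sum T {..<n}))" if nz: "f \<noteq> (\<lambda>p\<in>X. 0)"
  proof -
    have "\<exists>l. l < n \<and> q l \<noteq> 0"
    proof (rule ccontr)
      assume "\<not> ?thesis"
      then have "f p = 0" if "p \<in> X" for p using nq[OF that] by simp
      then show False
        using nz regular_functions_restrict[OF f] by (metis (mono_tags, lifting) restrict_ext)
    qed
    define L where "L = (GREATEST l. l < n \<and> q l \<noteq> 0)"
    have L: "L < n" "q L \<noteq> 0"
      using GreatestI_ex_nat[OF \<open>\<exists>l. l < n \<and> q l \<noteq> 0\<close>, of n] by (auto simp: L_def)
    have L_max: "l \<le> L" if "l < n" "q l \<noteq> 0" for l
      unfolding L_def by (rule Greatest_le_nat[of _ _ n]) (use that in auto)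
    have "sum T {..<n} = sum T {..L}"
      using L(1) L_max by (intro sum.mono_neutral_right) (force simp: T_def y_laurent_def)+
    also have "\<dots> = sum T {..<L} + T L" by (simp add: lessThan_Suc_atMost[symmetric])
    finally have split: "sum T {..<n} = y_laurent (q L) * single (basis_exponent L) 1 +
        (y_laurent (q L) * R L + sum T {..<L})"
      by (simp add: T_def distrib_left add_ac)
    have rest: "y_laurent (q L) * R L + sum T {..<L} \<in> z_bounded L"
      using z_bounded_mult[OF z_bounded_y_laurent R(1)[of L], of "q L"]
      by (intro z_bounded_add z_bounded_sum) (auto intro: z_bounded_mono[OF T])
    have keys: "\<exists>a. m = y_exponent a + basis_exponent L"
      if "m \<in> keys (y_laurent (q L) * single (basis_exponent L) 1)" for m
    proof -
      from that keys_mult[of "y_laurent (q L)" "single (basis_exponent L) 1"]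
      obtain b where "b \<in> keys (y_laurent (q L))" "m = b + basis_exponent L"
        by (auto split: if_splits)
      then show ?thesis using keys_y_laurent by blast
    qed
    have keys_Z: "lookup m VZ = int L"
      if "m \<in> keys (y_laurent (q L) * single (basis_exponent L) 1)" for m
      using keys[OF that] by (auto simp: lookup_add basis_exponent_def)
    have nz: "y_laurent (q L) * single (basis_exponent L) 1 \<noteq> 0"
      using L(2) by (metis keys_single keys_zero insert_not_empty mult_eq_0_iff y_laurent_eq_0_iff zero_neq_one)
    have "admissible m" if "m \<in> keys (y_laurent (q L) * single (basis_exponent L) 1)" for m
      using keys[OF that] unfolding admissible_def
      by (intro exI[of _ L]) (auto simp: lookup_add basis_exponent_def)
    with z_bounded_top[OF nz keys_Z rest] show ?thesis unfolding split by blast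
  qed
  ultimately show ?thesis by blast
qed

definition expansion :: "(('n coord \<Rightarrow> 'k) \<Rightarrow> 'k) \<Rightarrow> ('n, 'k) laurent" where
  "expansion f = (THE F. expands f F)"

lemma expansion_eqI: "expands f F \<Longrightarrow> expansion f = F"
  unfolding expansion_def using expands_unique by blast

lemma expands_expansion: "f \<in> regular_functions X \<Longrightarrow> expands f (expansion f)"
  using expansion_exists expansion_eqI by metis

lemma expansion_z_nonneg: "f \<in> regular_functions X \<Longrightarrow> m \<in> keys (expansion f) \<Longrightarrow> lookup m VZ \<ge> 0"
  using expansion_exists[of f] expansion_eqI by metis

lemma expansion_0 [simp]: "expansion (\<lambda>p\<in>X. 0) = 0"
  by (rule expansion_eqI) (simp add: expands_0)

lemma expansion_eq_0_iff: "f \<in> regular_functions X \<Longrightarrow> expansion f = 0 \<longleftrightarrow> f = (\<lambda>p\<in>X. 0)"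
  using expansion_exists[of f] expansion_eqI expansion_0 by metis

lemma admissible_lead:
  assumes "f \<in> regular_functions X" "expansion f \<noteq> 0"
  shows "admissible (lead (expansion f))"
  using expansion_exists[OF assms(1)] expansion_eqI expansion_eq_0_iff assms by metis

end

section \<open>The arithmetic obstruction\<close>

text \<open>
  Here \<open>(a, b)\<close> is the shift of exponents by the leading part of a locally nilpotent derivation
  (\<open>b\<close> in the direction of \<open>z\<close>), and \<open>l\<close>, \<open>lz\<close> count the steps after which its symbol vanishes,
  starting from \<open>y\<^sub>i\<close> and from \<open>z\<close>. The assumption \<open>x\<close> says that the corresponding count for the function
  \<open>x\<close> is nonnegative; \<open>y\<close> and \<open>z\<close> say that the images of \<open>y\<^sub>i\<close> and \<open>z\<close> have leading exponents that occur
  in \<open>\<K>[X]\<close>. By \<open>x\<close> and \<open>e\<close>, the shift lies strictly outside the cone of these exponents, for some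
  \<open>y\<^sub>i\<close> that it can be applied to. The image of \<open>z\<close> then needs more factors \<open>x\<close> than the image of
  \<open>y\<^sub>i\<close> has, although its degree is only larger by one. With \<open>j = b div d\<close> this leaves
  \<open>a\<^sub>i = -1 - k\<^sub>i j\<close> and \<open>b \<ge> (j + 1) d - 1\<close>, and being outside the cone becomes
  \<open>k\<^sub>i d < k\<^sub>i + d\<close>, which fails when both are at least \<open>2\<close>.
\<close>

lemma no_leading_exponent:
  fixes k :: "'n::finite \<Rightarrow> nat" and a l :: "'n \<Rightarrow> int" and b lz :: int
  assumes d: "d \<ge> 2" and k: "\<And>i. k i \<ge> 2" and b: "b \<ge> 0"
    and l: "\<And>i. l i \<ge> 0" and lz: "lz \<ge> 0"
    and x: "(\<Sum>i\<in>UNIV. int (k i) * l i) \<le> int d * lz"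
    and e: "(\<Sum>i\<in>UNIV. l i * a i) + lz * b = -1"
    and y: "\<And>i. l i > 0 \<Longrightarrow> a i + 1 \<ge> - int (k i * (nat b div d))"
    and z: "\<And>i. lz > 0 \<Longrightarrow> a i \<ge> - int (k i * (nat (b + 1) div d))"
  shows False
proof -
  \<comment> \<open>the cone is given by \<open>d a\<^sub>i + k\<^sub>i b \<ge> 0\<close>; averaging with weights \<open>l\<close> finds a violated inequality\<close>
  have "(\<Sum>i\<in>UNIV. l i * (int d * a i + int (k i) * b)) =
      int d * (\<Sum>i\<in>UNIV. l i * a i) + b * (\<Sum>i\<in>UNIV. int (k i) * l i)"
    by (simp add: sum_distrib_left sum.distrib algebra_simps)
  also have "\<dots> \<le> int d * (\<Sum>i\<in>UNIV. l i * a i) + b * (int d * lz)"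
    using mult_left_mono[OF x b] by simp
  also have "\<dots> = int d * ((\<Sum>i\<in>UNIV. l i * a i) + lz * b)"
    by (simp add: algebra_simps)
  also have "\<dots> < 0" using d by (simp add: e)
  finally have "\<not> (\<Sum>i\<in>UNIV. l i * (int d * a i + int (k i) * b)) \<ge> 0" by simp
  then obtain i where i: "l i * (int d * a i + int (k i) * b) < 0"
    using sum_nonneg[of UNIV "\<lambda>i. l i * (int d * a i + int (k i) * b)"] by (meson not_le)
  then have li: "l i > 0" and neg: "int d * a i + int (k i) * b < 0"
    using l[of i] by (auto simp: mult_less_0_iff)
  have "int (k i) * l i \<le> (\<Sum>i\<in>UNIV. int (k i) * l i)"
    by (rule member_le_sum) (use l in auto)
  moreover have "int (k i) * l i > 0" using li k[of i] by simp
  ultimately have "int d * lz > 0" using x by linarith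
  then have lz: "lz > 0" using d by (simp add: zero_less_mult_iff)
  define q where "q = nat b"
  define j where "j = int (q div d)"
  define j' where "j' = int (Suc q div d)"
  have b: "b = int q" "nat (b + 1) = Suc q" using b by (auto simp: q_def)
  have jd: "j * int d \<le> int q"
    unfolding j_def of_nat_mult[symmetric] of_nat_le_iff by simp
  have j'd: "j' * int d \<le> int q + 1"
    unfolding j'_def of_nat_mult[symmetric] using div_times_less_eq_dividend[of "Suc q" d] by linarith
  have y: "a i + 1 \<ge> - (int (k i) * j)" using y[OF li] by (simp add: b j_def)
  have z: "a i \<ge> - (int (k i) * j')" using z[OF lz, of i] by (simp add: b(2) j'_def)
  have "int (k i) * (j * int d) \<le> int (k i) * int q"
    by (rule mult_left_mono[OF jd]) simp
  then have "int d * (a i + int (k i) * j) < 0"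
    using neg by (simp add: b(1) algebra_simps)
  then have a: "a i < - (int (k i) * j)" by (auto simp: mult_less_0_iff)
  with z have "int (k i) * j < int (k i) * j'" by linarith
  \<comment> \<open>the image of \<open>z\<close> needs a factor \<open>x\<close> more than fits into the degree of the image of \<open>y\<^sub>i\<close>\<close>
  then have "j + 1 \<le> j'" by (auto simp: mult_less_cancel_left)
  then have "(j + 1) * int d \<le> j' * int d" by (rule mult_right_mono) simp
  with j'd have "(j + 1) * int d - 1 \<le> int q" by linarith
  from mult_left_mono[OF this, of "int (k i)"]
  have lower: "int (k i) * ((j + 1) * int d - 1) \<le> int (k i) * int q" by simp
  have a: "a i = - 1 - int (k i) * j" using a y by linarith
  have "int (k i) * int q < int d * (1 + int (k i) * j)"
    using neg unfolding a b(1) by (simp add: algebra_simps)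
  with lower have "int (k i) * (int d - 1) < int d" by (simp add: algebra_simps)
  moreover have "2 * (int d - 1) \<le> int (k i) * (int d - 1)"
    using k[of i] d by (intro mult_right_mono) auto
  ultimately show False using d by simp
qed

section \<open>Derivations of the coordinate ring\<close>

context danielewski_variety
begin

lemma restrict_algebra:
  "(\<lambda>p\<in>X. (\<lambda>p\<in>X. f p) p + (\<lambda>p\<in>X. g p) p) = (\<lambda>p\<in>X. f p + g p)"
  "(\<lambda>p\<in>X. (\<lambda>p\<in>X. f p) p * (\<lambda>p\<in>X. g p) p) = (\<lambda>p\<in>X. f p * g p)"
  by (auto simp: restrict_def)

lemma expansion_add:
  "f \<in> regular_functions X \<Longrightarrow> g \<in> regular_functions X \<Longrightarrow>
   expansion (\<lambda>p\<in>X. f p + g p) = expansion f + expansion g"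
  by (intro expansion_eqI) (simp add: expands_add expands_expansion)

lemma expansion_mult:
  "f \<in> regular_functions X \<Longrightarrow> g \<in> regular_functions X \<Longrightarrow>
   expansion (\<lambda>p\<in>X. f p * g p) = expansion f * expansion g"
  by (intro expansion_eqI) (simp add: expands_mult expands_expansion)

lemma expansion_const: "expansion (\<lambda>p\<in>X. a) = single 0 a"
  by (intro expansion_eqI) (simp add: expands_const)

lemma expansion_coord: "expansion (\<lambda>p\<in>X. p (coord_of v)) = single (single v 1) 1"
  by (intro expansion_eqI) (simp add: expands_coord)

lemma expansion_y: "expansion (\<lambda>p\<in>X. mpoly_eval q (y_of p)) = y_laurent q"
  by (intro expansion_eqI) (simp add: expands_y)

lemma lead_expansion_x:
  "expansion (\<lambda>p\<in>X. p Cx) \<noteq> 0" "lead (expansion (\<lambda>p\<in>X. p Cx)) = x_exponent"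
proof -
  have x: "expansion (\<lambda>p\<in>X. p Cx) = single x_exponent 1 + x_tail"
    by (intro expansion_eqI) (simp add: expands_x)
  have nz: "single x_exponent (1::'k) \<noteq> 0"
    by (metis keys_single keys_zero insert_not_empty zero_neq_one)
  show "expansion (\<lambda>p\<in>X. p Cx) \<noteq> 0" "lead (expansion (\<lambda>p\<in>X. p Cx)) = x_exponent"
    using z_bounded_top[OF nz _ z_bounded_x_tail] unfolding x by (simp_all add: x_exponent_def)
qed

end

locale danielewski_derivation = danielewski_variety k d s
  for k :: "'n::finite \<Rightarrow> nat" and d and s :: "nat \<Rightarrow> ('n \<Rightarrow>\<^sub>0 nat) \<Rightarrow>\<^sub>0 'k::field_char_0" +
  fixes \<delta> :: "(('n coord \<Rightarrow> 'k) \<Rightarrow> 'k) \<Rightarrow> (('n coord \<Rightarrow> 'k) \<Rightarrow> 'k)"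
  assumes derivation: "derivation X \<delta>"
begin

lemma \<delta>_regular: "f \<in> regular_functions X \<Longrightarrow> \<delta> f \<in> regular_functions X"
  using derivation by (auto simp: derivation_def)

lemma \<delta>_add:
  "f \<in> regular_functions X \<Longrightarrow> g \<in> regular_functions X \<Longrightarrow>
   \<delta> (\<lambda>p\<in>X. f p + g p) = (\<lambda>p\<in>X. \<delta> f p + \<delta> g p)"
  using derivation by (auto simp: derivation_def)

lemma \<delta>_mult:
  "f \<in> regular_functions X \<Longrightarrow> g \<in> regular_functions X \<Longrightarrow>
   \<delta> (\<lambda>p\<in>X. f p * g p) = (\<lambda>p\<in>X. \<delta> f p * g p + f p * \<delta> g p)"
  using derivation by (auto simp: derivation_def)

lemma expansion_\<delta>_add:
  assumes "f \<in> regular_functions X" "g \<in> regular_functions X"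
  shows "expansion (\<delta> (\<lambda>p\<in>X. f p + g p)) = expansion (\<delta> f) + expansion (\<delta> g)"
  unfolding \<delta>_add[OF assms] by (intro expansion_add \<delta>_regular assms)

lemma expansion_\<delta>_mult:
  assumes "f \<in> regular_functions X" "g \<in> regular_functions X"
  shows "expansion (\<delta> (\<lambda>p\<in>X. f p * g p)) =
    expansion (\<delta> f) * expansion g + expansion f * expansion (\<delta> g)"
  unfolding \<delta>_mult[OF assms]
  by (intro expansion_eqI) (simp add: expands_add expands_mult expands_expansion \<delta>_regular assms)

lemma expansion_\<delta>_const: "expansion (\<delta> (\<lambda>p\<in>X. a)) = 0"
proof -
  let ?one = "\<lambda>p\<in>X. 1 :: 'k"
  have one: "?one \<in> regular_functions X" by blast
  have eq: "(\<lambda>p\<in>X. a * ?one p) = (\<lambda>p\<in>X. a)" "(\<lambda>p\<in>X. ?one p * ?one p) = ?one" for a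
    by (auto simp: restrict_def)
  have "expansion (\<delta> ?one) = 0"
    using expansion_\<delta>_mult[OF one one] unfolding eq expansion_const by simp
  then have zero: "\<delta> ?one = (\<lambda>p\<in>X. 0)"
    using expansion_eq_0_iff[OF \<delta>_regular[OF one]] by simp
  have "\<delta> (\<lambda>p\<in>X. a * ?one p) = (\<lambda>p\<in>X. a * \<delta> ?one p)"
    using derivation one unfolding derivation_def by blast
  then have "\<delta> (\<lambda>p\<in>X. a) = (\<lambda>p\<in>X. 0)" unfolding eq zero by (auto simp: restrict_def)
  then show ?thesis by simp
qed

text \<open>
  The logarithmic derivative \<open>\<delta>(v) / v\<close>, expanded on the torus.
\<close>

definition log_coeff :: "'n var \<Rightarrow> ('n, 'k) laurent" where
  "log_coeff v = expansion (\<delta> (\<lambda>p\<in>X. p (coord_of v))) * single (single v (-1)) 1"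

text \<open>
  The functions on which \<open>\<delta>\<close> agrees with the derivation of Laurent polynomials that has the same
  values on \<open>z\<close> and the \<open>y\<^sub>i\<close>. The restriction to \<open>X\<close> is inside, so that closure properties can be
  stated for arbitrary expressions in the coordinates.
\<close>

definition intertwined :: "(('n coord \<Rightarrow> 'k) \<Rightarrow> 'k) \<Rightarrow> bool" where
  "intertwined f \<longleftrightarrow> (\<lambda>p\<in>X. f p) \<in> regular_functions X \<and>
     expansion (\<delta> (\<lambda>p\<in>X. f p)) = torus_derivation log_coeff (expansion (\<lambda>p\<in>X. f p))"

lemma intertwined_const: "intertwined (\<lambda>p. a)"
  by (auto simp: intertwined_def expansion_\<delta>_const expansion_const torus_derivation_const)

lemma intertwined_coord: "intertwined (\<lambda>p. p (coord_of v))"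
  by (auto simp: intertwined_def expansion_coord torus_derivation_coord log_coeff_def
      mult.assoc mult_single single_add[symmetric])

lemma intertwined_add: "intertwined f \<Longrightarrow> intertwined g \<Longrightarrow> intertwined (\<lambda>p. f p + g p)"
  unfolding intertwined_def
  using expansion_\<delta>_add[of "\<lambda>p\<in>X. f p" "\<lambda>p\<in>X. g p"] expansion_add[of "\<lambda>p\<in>X. f p" "\<lambda>p\<in>X. g p"]
  unfolding restrict_algebra by (simp add: regular_functions_add torus_derivation_add)

lemma intertwined_mult: "intertwined f \<Longrightarrow> intertwined g \<Longrightarrow> intertwined (\<lambda>p. f p * g p)"
  unfolding intertwined_def
  using expansion_\<delta>_mult[of "\<lambda>p\<in>X. f p" "\<lambda>p\<in>X. g p"] expansion_mult[of "\<lambda>p\<in>X. f p" "\<lambda>p\<in>X. g p"]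
  unfolding restrict_algebra by (simp add: regular_functions_mult torus_derivation_mult)

lemma intertwined_sum:
  assumes "\<And>i. i \<in> I \<Longrightarrow> intertwined (f i)"
  shows "intertwined (\<lambda>p. \<Sum>i\<in>I. f i p)"
  using assms
  by (induction I rule: infinite_finite_induct) (auto intro: intertwined_add intertwined_const)

lemma intertwined_prod:
  assumes "\<And>i. i \<in> I \<Longrightarrow> intertwined (f i)"
  shows "intertwined (\<lambda>p. \<Prod>i\<in>I. f i p)"
  using assms
  by (induction I rule: infinite_finite_induct) (auto intro: intertwined_mult intertwined_const)

lemma intertwined_power: "intertwined f \<Longrightarrow> intertwined (\<lambda>p. f p ^ n)"
  by (induction n) (auto intro: intertwined_mult intertwined_const)

lemma intertwined_y: "intertwined (\<lambda>p. mpoly_eval q (y_of p))"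
  unfolding mpoly_eval_def y_of_def
  by (intro intertwined_sum intertwined_mult intertwined_prod intertwined_power intertwined_const
      intertwined_coord[of "VY _", simplified])

text \<open>
  By the equation of \<open>X\<close>, the product of \<open>x\<close> and \<open>y^k\<close> is a polynomial in \<open>y, z\<close>, so both derivations
  agree on it and on \<open>y^k\<close>; the product rule and cancelling \<open>y^k\<close> give the agreement on \<open>x\<close>.
\<close>

lemma intertwined_x: "intertwined (\<lambda>p. p Cx)"
proof -
  let ?x = "\<lambda>p\<in>X. p Cx :: 'k" and ?M = "\<lambda>p\<in>X. mpoly_eval y_monomial (y_of p)"
  let ?Q = "\<lambda>p. p Cz ^ d + (\<Sum>j<d. mpoly_eval (s j) (y_of p) * p Cz ^ j)"
  have x: "?x \<in> regular_functions X" by blast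
  have M: "?M \<in> regular_functions X" using intertwined_y by (simp add: intertwined_def)
  have "intertwined ?Q"
    by (intro intertwined_add intertwined_sum intertwined_mult intertwined_power intertwined_y
        intertwined_coord[of VZ, simplified])
  moreover have "(\<lambda>p\<in>X. ?Q p) = (\<lambda>p\<in>X. ?x p * ?M p)"
    by (auto simp: X_iff intro!: restrict_ext)
  ultimately have "expansion (\<delta> (\<lambda>p\<in>X. ?x p * ?M p)) =
      torus_derivation log_coeff (expansion (\<lambda>p\<in>X. ?x p * ?M p))"
    unfolding intertwined_def by simp
  then have "expansion (\<delta> ?x) * expansion ?M + expansion ?x * expansion (\<delta> ?M) =
      torus_derivation log_coeff (expansion ?x) * expansion ?M +
      expansion ?x * torus_derivation log_coeff (expansion ?M)"
    unfolding expansion_\<delta>_mult[OF x M] expansion_mult[OF x M] torus_derivation_mult .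
  moreover have "expansion (\<delta> ?M) = torus_derivation log_coeff (expansion ?M)"
    using intertwined_y by (simp add: intertwined_def)
  ultimately have "expansion (\<delta> ?x) * expansion ?M =
      torus_derivation log_coeff (expansion ?x) * expansion ?M" by simp
  moreover have "expansion ?M \<noteq> 0"
    unfolding expansion_y y_laurent_eq_0_iff y_monomial_def
    by (metis keys_single keys_zero insert_not_empty zero_neq_one)
  ultimately show ?thesis using x by (simp add: intertwined_def)
qed

lemma expansion_\<delta>:
  assumes "f \<in> regular_functions X"
  shows "expansion (\<delta> f) = torus_derivation log_coeff (expansion f)"
  using assms
proof (induction rule: regular_functions_induct)
  case (const c)
  then show ?case using intertwined_const unfolding intertwined_def by blast
next
  case (coord v)
  show ?case
    using intertwined_x intertwined_coord[of VZ] intertwined_coord[of "VY _"]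
    by (cases v) (simp_all only: intertwined_def coord_of.simps)
next
  case (add f g)
  then show ?case by (simp only: expansion_\<delta>_add expansion_add torus_derivation_add)
next
  case (mult f g)
  then show ?case by (simp only: expansion_\<delta>_mult expansion_mult torus_derivation_mult)
qed

lemma \<delta>_power_regular: "f \<in> regular_functions X \<Longrightarrow> (\<delta> ^^ n) f \<in> regular_functions X"
  by (induction n) (auto intro: \<delta>_regular)

lemma expansion_\<delta>_power:
  "f \<in> regular_functions X \<Longrightarrow>
   expansion ((\<delta> ^^ n) f) = (torus_derivation log_coeff ^^ n) (expansion f)"
  by (induction n) (simp_all add: expansion_\<delta> \<delta>_power_regular)

lemma keys_log_coeff:
  assumes "m \<in> keys (log_coeff v)"
  shows "lookup m VZ \<ge> (if v = VZ then -1 else 0)"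
proof -
  have "(\<lambda>p\<in>X. p (coord_of v)) \<in> regular_functions X" by blast
  from expansion_z_nonneg[OF \<delta>_regular[OF this]] show ?thesis
    using assms keys_mult[of "expansion (\<delta> (\<lambda>p\<in>X. p (coord_of v)))" "single (single v (-1)) 1"]
    by (fastforce simp: log_coeff_def lookup_add lookup_single when_def split: if_splits)
qed

text \<open>
  In the direction of \<open>z\<close>: \<open>\<delta>\<close> vanishes on the \<open>y\<^sub>i\<close>, and \<open>\<delta>(z)\<close> is nonzero and free of \<open>z\<close>.
\<close>

definition vertical :: bool where
  "vertical \<longleftrightarrow> (\<forall>i. log_coeff (VY i) = 0) \<and> log_coeff VZ \<noteq> 0 \<and>
     (\<forall>m\<in>keys (log_coeff VZ). lookup m VZ = -1)"

lemma vertical_nilpotency: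
  assumes "vertical" "f \<in> regular_functions X"
  shows "(\<delta> ^^ n) f = (\<lambda>p\<in>X. 0) \<longleftrightarrow> (\<forall>m\<in>keys (expansion f). lookup m VZ < int n)"
  using assms vertical_derivation_nilpotency[of log_coeff "expansion f" n]
  by (simp add: vertical_def expansion_z_nonneg expansion_\<delta>_power \<delta>_power_regular
      flip: expansion_eq_0_iff)

text \<open>
  Let \<open>e\<close> be the leading exponent of \<open>\<delta>\<close>. If its exponent of \<open>z\<close> is negative then, the order putting \<open>z\<close>
  first, all exponents in \<open>\<delta>\<close> have a negative exponent of \<open>z\<close>; those coming from \<open>\<delta>(y\<^sub>i)\<close> cannot, so
  \<open>\<delta>(y\<^sub>i) = 0\<close>, and those coming from \<open>\<delta>(z)\<close> must then have exponent exactly \<open>-1\<close>. Otherwise local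
  nilpotency, tested on \<open>x\<close>, \<open>z\<close> and the \<open>y\<^sub>i\<close>, makes the symbol integral and nonnegative on their
  leading exponents, up to a common factor, which is arithmetically impossible.
\<close>

lemma locally_nilpotent_vertical:
  assumes nil: "\<And>f. f \<in> regular_functions X \<Longrightarrow> \<exists>n. (\<delta> ^^ n) f = (\<lambda>p\<in>X. 0)"
    and nz: "f \<in> regular_functions X" "\<delta> f \<noteq> (\<lambda>p\<in>X. 0)"
  shows "vertical"
proof -
  define E where "E = (\<Union>v. keys (log_coeff v))"
  have fin: "finite E" by (simp add: E_def)
  have "E \<noteq> {}"
  proof
    assume "E = {}"
    then have "log_coeff v = 0" for v by (auto simp: E_def)
    then have "expansion (\<delta> f) = 0"
      by (simp add: expansion_\<delta>[OF nz(1)] torus_derivation_def)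
    then show False using nz by (simp add: expansion_eq_0_iff \<delta>_regular)
  qed
  define e where "e = Max E"
  have e_in: "e \<in> E" unfolding e_def using fin \<open>E \<noteq> {}\<close> by (rule Max_in)
  have e_max: "m \<le> e" if "m \<in> keys (log_coeff v)" for m v
    unfolding e_def using that fin by (intro Max_ge) (auto simp: E_def)
  have "\<not> lookup e VZ \<ge> 0"
  proof
    assume b: "lookup e VZ \<ge> 0"
    \<comment> \<open>\<open>\<mu>\<close> is the common factor; it is nonzero because the symbol is not identically zero\<close>
    define \<mu> where "\<mu> = - symbol log_coeff e e"
    have multiple: "\<exists>n. symbol log_coeff e (lead (expansion g)) = of_nat n * \<mu>"
      if g: "g \<in> regular_functions X" "expansion g \<noteq> 0" for g
    proof -
      obtain n where "(\<delta> ^^ n) g = (\<lambda>p\<in>X. 0)" using nil[OF g(1)] by blast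
      then have "(torus_derivation log_coeff ^^ n) (expansion g) = 0"
        using expansion_\<delta>_power[OF g(1), of n] by simp
      from symbol_nilpotent[OF e_max g(2) this] show ?thesis by (simp add: \<mu>_def)
    qed
    have coord: "expansion (\<lambda>p\<in>X. p (coord_of v)) \<noteq> 0"
      "lead (expansion (\<lambda>p\<in>X. p (coord_of v))) = single v 1" for v
      unfolding expansion_coord
      by (metis keys_single keys_zero insert_not_empty zero_neq_one) (intro lead_eqI; simp)
    have "\<exists>n. lookup (log_coeff v) e = of_nat n * \<mu>" for v
      using multiple[OF _ coord(1)[of v]] unfolding coord symbol_single by blast
    then obtain l where l: "\<And>v. lookup (log_coeff v) e = of_nat (l v) * \<mu>" by metis
    obtain n where n: "symbol log_coeff e x_exponent = of_nat n * \<mu>"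
      using multiple[OF _ lead_expansion_x(1)] unfolding lead_expansion_x(2) by blast
    obtain v where "lookup (log_coeff v) e \<noteq> 0" using e_in by (auto simp: E_def in_keys_iff)
    then have \<mu>: "\<mu> \<noteq> 0" by (auto simp: l)
    have symbol: "symbol log_coeff e m = \<mu> * of_int (\<Sum>v\<in>UNIV. int (l v) * lookup m v)" for m
      by (simp add: symbol_def l sum_distrib_left mult_ac)
    have split: "(\<Sum>v\<in>UNIV. g v) = g VZ + (\<Sum>i\<in>UNIV. g (VY i))" for g :: "'n var \<Rightarrow> int"
      by (simp add: UNIV_var sum.insert_if sum.reindex inj_def image_iff)
    have "\<mu> * of_int (\<Sum>v\<in>UNIV. int (l v) * lookup e v) = \<mu> * of_int (-1)"
      using symbol[of e] by (simp add: \<mu>_def)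
    then have sum_e: "(\<Sum>v\<in>UNIV. int (l v) * lookup e v) = -1"
      unfolding mult_left_cancel[OF \<mu>] of_int_eq_iff .
    have "\<mu> * of_int (\<Sum>v\<in>UNIV. int (l v) * lookup x_exponent v) = \<mu> * of_int (int n)"
      using symbol[of x_exponent] n by (simp only: of_int_of_nat_eq mult.commute[of \<mu>])
    then have sum_x: "(\<Sum>v\<in>UNIV. int (l v) * lookup x_exponent v) = int n"
      unfolding mult_left_cancel[OF \<mu>] of_int_eq_iff .
    have admissible: "admissible (e + single v 1)" if "l v > 0" for v
    proof -
      have reg: "(\<lambda>p\<in>X. p (coord_of v)) \<in> regular_functions X" by blast
      have "symbol log_coeff e (lead (expansion (\<lambda>p\<in>X. p (coord_of v)))) \<noteq> 0"
        unfolding coord symbol_single l using that \<mu> by simp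
      from lead_torus_derivation[OF e_max coord(1) this]
      show ?thesis
        using admissible_lead[OF \<delta>_regular[OF reg]] unfolding expansion_\<delta>[OF reg] coord by simp
    qed
    show False
    proof (rule no_leading_exponent[OF d_ge_2 k_ge_2 b,
          where l = "\<lambda>i. int (l (VY i))" and a = "\<lambda>i. lookup e (VY i)" and lz = "int (l VZ)"])
      show "(\<Sum>i\<in>UNIV. int (k i) * int (l (VY i))) \<le> int d * int (l VZ)"
        using sum_x unfolding split by (simp add: x_exponent_def sum_negf mult_ac)
      show "(\<Sum>i\<in>UNIV. int (l (VY i)) * lookup e (VY i)) + int (l VZ) * lookup e VZ = - 1"
        using sum_e unfolding split by simp
    next
      fix i assume "int (l (VY i)) > 0"
      then show "- int (k i * (nat (lookup e VZ) div d)) \<le> lookup e (VY i) + 1"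
        using admissible[of "VY i"] unfolding admissible_def
        by (auto simp: lookup_add lookup_single dest: spec[of _ i])
    next
      fix i assume "int (l VZ) > 0"
      then show "- int (k i * (nat (lookup e VZ + 1) div d)) \<le> lookup e (VY i)"
        using admissible[of VZ] unfolding admissible_def
        by (auto simp: lookup_add lookup_single dest: spec[of _ i])
    qed simp_all
  qed
  then have small: "lookup m VZ < 0" if "m \<in> keys (log_coeff v)" for m v
    using VZ_mono[OF e_max[OF that]] by simp
  have Y: "log_coeff (VY i) = 0" for i
  proof (rule ccontr)
    assume "log_coeff (VY i) \<noteq> 0"
    from lead_in_keys[OF this] show False using small keys_log_coeff by fastforce
  qed
  moreover have "log_coeff VZ \<noteq> 0"
  proof
    assume "log_coeff VZ = 0"
    then have "log_coeff v = 0" for v using Y by (cases v) auto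
    then show False using e_in by (simp add: E_def)
  qed
  moreover have "lookup m VZ = -1" if "m \<in> keys (log_coeff VZ)" for m
    using small[OF that] keys_log_coeff[OF that] by simp
  ultimately show ?thesis by (simp add: vertical_def)
qed

end

section \<open>Invariance of the filtration\<close>

context danielewski_variety
begin

lemma canonical_vertical:
  assumes "canonical_LND k d s D"
  shows "danielewski_derivation k d s D" "danielewski_derivation.vertical k d s D"
proof -
  have D: "derivation X D" "\<And>i. D (\<lambda>p\<in>X. p (Cy i)) = (\<lambda>p\<in>X. 0)"
    "D (\<lambda>p\<in>X. p Cz) = (\<lambda>p\<in>X. mpoly_eval y_monomial (y_of p))"
    using assms by (auto simp: canonical_LND_def X_def Let_def eval_y_monomial y_of_def)
  then show "danielewski_derivation k d s D"
    by unfold_locales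
  then interpret danielewski_derivation k d s D .
  have Z: "log_coeff VZ = y_laurent y_monomial * single (single VZ (-1)) 1"
    by (simp add: log_coeff_def D expansion_y)
  have "lookup m VZ = -1" if "m \<in> keys (log_coeff VZ)" for m
    using that keys_mult[of "y_laurent y_monomial" "single (single VZ (-1)) 1"] keys_y_laurent
    unfolding Z by (fastforce simp: lookup_add lookup_single split: if_splits)
  moreover have "log_coeff VZ \<noteq> 0"
    unfolding Z mult_eq_0_iff y_laurent_eq_0_iff y_monomial_def
    by (metis keys_single keys_zero insert_not_empty zero_neq_one)
  moreover have "log_coeff (VY i) = 0" for i
    by (simp add: log_coeff_def D)
  ultimately show "danielewski_derivation.vertical k d s D"
    by (simp add: vertical_def)
qed

lemma pullback_regular:
  assumes "morphism X X \<psi>" "f \<in> regular_functions X"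
  shows "pullback X \<psi> f \<in> regular_functions X"
proof -
  obtain F where F: "f = (\<lambda>p\<in>X. mpoly_eval F p)"
    using assms(2) by (auto simp: regular_functions_def)
  have "pullback X \<psi> f = (\<lambda>p\<in>X. mpoly_eval F (\<psi> p))"
    using assms(1) by (auto simp: pullback_def F morphism_def Pi_iff intro!: restrict_ext)
  also have "\<dots> \<in> regular_functions X"
    using assms(1) by (intro regular_functions_compose) (simp add: morphism_def)
  finally show ?thesis .
qed

lemma pullback_inverse:
  assumes "morphism X X \<psi>" "\<And>p. p \<in> X \<Longrightarrow> \<phi> (\<psi> p) = p" "f \<in> regular_functions X"
  shows "pullback X \<psi> (pullback X \<phi> f) = f"
proof -
  have "pullback X \<psi> (pullback X \<phi> f) = (\<lambda>p\<in>X. f p)"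
    using assms(1,2) by (auto simp: pullback_def morphism_def Pi_iff intro!: restrict_ext)
  then show ?thesis by (simp add: regular_functions_restrict[OF assms(3)])
qed

lemma conjugate_derivation:
  assumes D: "derivation X D" and \<psi>: "morphism X X \<psi>" and \<phi>: "morphism X X \<phi>"
    and inv: "\<And>p. p \<in> X \<Longrightarrow> \<phi> (\<psi> p) = p"
  shows "derivation X (\<lambda>f. pullback X \<psi> (D (pullback X \<phi> f)))"
proof -
  note \<psi>_reg = pullback_regular[OF \<psi>] and \<phi>_reg = pullback_regular[OF \<phi>]
  have XX: "\<psi> p \<in> X" "\<phi> p \<in> X" if "p \<in> X" for p
    using \<psi> \<phi> that by (auto simp: morphism_def)
  have D_reg: "D f \<in> regular_functions X" if "f \<in> regular_functions X" for f
    using D that by (auto simp: derivation_def)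
  have D_add: "D (\<lambda>p\<in>X. f p + g p) = (\<lambda>p\<in>X. D f p + D g p)"
    and D_mult: "D (\<lambda>p\<in>X. f p * g p) = (\<lambda>p\<in>X. D f p * g p + f p * D g p)"
    and D_scale: "D (\<lambda>p\<in>X. c * f p) = (\<lambda>p\<in>X. c * D f p)"
    if "f \<in> regular_functions X" "g \<in> regular_functions X" for f g c
    using D that by (auto simp: derivation_def)
  have pull: "pullback X \<phi> (\<lambda>p\<in>X. f p + g p) = (\<lambda>p\<in>X. pullback X \<phi> f p + pullback X \<phi> g p)"
    "pullback X \<phi> (\<lambda>p\<in>X. f p * g p) = (\<lambda>p\<in>X. pullback X \<phi> f p * pullback X \<phi> g p)"
    "pullback X \<phi> (\<lambda>p\<in>X. c * f p) = (\<lambda>p\<in>X. c * pullback X \<phi> f p)" for f g c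
    by (auto simp: pullback_def XX intro!: restrict_ext)
  have \<phi>_\<psi>: "pullback X \<phi> f (\<psi> p) = f p" if "p \<in> X" for f p
    using that by (simp add: pullback_def XX inv)
  show ?thesis
    unfolding derivation_def
  proof (intro conjI ballI allI Pi_I)
    fix f assume "f \<in> regular_functions X"
    then show "pullback X \<psi> (D (pullback X \<phi> f)) \<in> regular_functions X"
      by (intro \<psi>_reg D_reg \<phi>_reg)
  next
    fix f g assume fg: "f \<in> regular_functions X" "g \<in> regular_functions X"
    note reg = \<phi>_reg[OF fg(1)] \<phi>_reg[OF fg(2)]
    show "pullback X \<psi> (D (pullback X \<phi> (\<lambda>p\<in>X. f p + g p))) =
        (\<lambda>p\<in>X. pullback X \<psi> (D (pullback X \<phi> f)) p + pullback X \<psi> (D (pullback X \<phi> g)) p)"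
      unfolding pull D_add[OF reg] by (auto simp: pullback_def[of X \<psi>] XX intro!: restrict_ext)
    show "pullback X \<psi> (D (pullback X \<phi> (\<lambda>p\<in>X. f p * g p))) =
        (\<lambda>p\<in>X. pullback X \<psi> (D (pullback X \<phi> f)) p * g p + f p * pullback X \<psi> (D (pullback X \<phi> g)) p)"
      unfolding pull D_mult[OF reg]
      by (auto simp: pullback_def[of X \<psi>] XX \<phi>_\<psi> intro!: restrict_ext)
  next
    fix c f assume f: "f \<in> regular_functions X"
    note reg = \<phi>_reg[OF f] \<phi>_reg[OF f]
    show "pullback X \<psi> (D (pullback X \<phi> (\<lambda>p\<in>X. c * f p))) =
        (\<lambda>p\<in>X. c * pullback X \<psi> (D (pullback X \<phi> f)) p)"
      unfolding pull(3) D_scale[OF reg] by (auto simp: pullback_def[of X \<psi>] XX intro!: restrict_ext)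
  qed
qed

text \<open>
  The conjugate \<open>\<delta>\<close> of \<open>D\<close> by \<open>\<psi>\<close> is again locally nilpotent and nonzero, so it points in the
  direction of \<open>z\<close> like \<open>D\<close>. Hence powers of \<open>\<delta>\<close> and of \<open>D\<close> annihilate the same functions, whereas by
  construction \<open>\<delta>^n\<close> annihilates \<open>\<psi>\<^sup>* f\<close> exactly if \<open>D^n\<close> annihilates \<open>f\<close>.
\<close>

lemma canonical_nilpotency_pullback:
  assumes can: "canonical_LND k d s D" and \<psi>: "morphism X X \<psi>" and \<phi>: "morphism X X \<phi>"
    and inv: "\<And>p. p \<in> X \<Longrightarrow> \<phi> (\<psi> p) = p" "\<And>p. p \<in> X \<Longrightarrow> \<psi> (\<phi> p) = p"
    and f: "f \<in> regular_functions X"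
  shows "(D ^^ n) (pullback X \<psi> f) = (\<lambda>p\<in>X. 0) \<longleftrightarrow> (D ^^ n) f = (\<lambda>p\<in>X. 0)"
proof -
  define \<delta> where "\<delta> f = pullback X \<psi> (D (pullback X \<phi> f))" for f
  interpret D: danielewski_derivation k d s D by (rule canonical_vertical[OF can])
  interpret \<delta>: danielewski_derivation k d s \<delta>
    unfolding \<delta>_def using conjugate_derivation[OF D.derivation \<psi> \<phi> inv(1)] by unfold_locales
  note \<psi>_reg = pullback_regular[OF \<psi>] and \<phi>_reg = pullback_regular[OF \<phi>]
  have \<psi>\<phi>: "pullback X \<psi> (pullback X \<phi> g) = g" and \<phi>\<psi>: "pullback X \<phi> (pullback X \<psi> g) = g"
    if "g \<in> regular_functions X" for g
    using pullback_inverse[OF \<psi> inv(1) that] pullback_inverse[OF \<phi> inv(2) that] by auto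
  have zero: "pullback X \<psi> (\<lambda>p\<in>X. 0) = (\<lambda>p\<in>X. 0)" "pullback X \<phi> (\<lambda>p\<in>X. 0) = (\<lambda>p\<in>X. 0)"
    using \<psi> \<phi> by (auto simp: pullback_def morphism_def Pi_iff intro!: restrict_ext)
  have pow: "(\<delta> ^^ n) (pullback X \<psi> g) = pullback X \<psi> ((D ^^ n) g)"
    if "g \<in> regular_functions X" for g n
    by (induction n) (simp_all add: \<delta>_def \<phi>\<psi> D.\<delta>_power_regular that)
  have zero_iff: "(\<delta> ^^ n) (pullback X \<psi> g) = (\<lambda>p\<in>X. 0) \<longleftrightarrow> (D ^^ n) g = (\<lambda>p\<in>X. 0)"
    if "g \<in> regular_functions X" for g n
    unfolding pow[OF that] using \<phi>\<psi>[OF D.\<delta>_power_regular[OF that]] zero by metis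
  have D_vertical: "D.vertical" by (rule canonical_vertical[OF can])
  have D_nil: "\<exists>n. (D ^^ n) g = (\<lambda>p\<in>X. 0)" if g: "g \<in> regular_functions X" for g
  proof -
    define N where "N = (\<Sum>m\<in>keys (expansion g). nat (lookup m VZ))"
    have "nat (lookup m VZ) \<le> N" if "m \<in> keys (expansion g)" for m
      unfolding N_def by (rule member_le_sum[OF that]) auto
    then have "\<forall>m\<in>keys (expansion g). lookup m VZ < int (Suc N)" by fastforce
    then show ?thesis using D.vertical_nilpotency[OF D_vertical g] by blast
  qed
  have "\<delta>.vertical"
  proof (rule \<delta>.locally_nilpotent_vertical)
    fix g assume g: "g \<in> regular_functions X"
    then show "\<exists>n. (\<delta> ^^ n) g = (\<lambda>p\<in>X. 0)"
      using D_nil[OF \<phi>_reg[OF g]] zero_iff[OF \<phi>_reg[OF g]] \<psi>\<phi>[OF g] by simp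
  next
    have z: "(\<lambda>p\<in>X. p Cz) \<in> regular_functions X" by blast
    show "pullback X \<psi> (\<lambda>p\<in>X. p Cz) \<in> regular_functions X" by (rule \<psi>_reg[OF z])
    have "keys (expansion (\<lambda>p\<in>X. p Cz)) = {single VZ 1}"
      using expansion_coord[of VZ] by simp
    then have "(D ^^ 1) (\<lambda>p\<in>X. p Cz) \<noteq> (\<lambda>p\<in>X. 0)"
      unfolding D.vertical_nilpotency[OF D_vertical z] by simp
    then show "\<delta> (pullback X \<psi> (\<lambda>p\<in>X. p Cz)) \<noteq> (\<lambda>p\<in>X. 0)"
      using zero_iff[OF z, of 1] by simp
  qed
  then have "(D ^^ n) (pullback X \<psi> f) = (\<lambda>p\<in>X. 0) \<longleftrightarrow> (\<delta> ^^ n) (pullback X \<psi> f) = (\<lambda>p\<in>X. 0)"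
    using D.vertical_nilpotency[OF D_vertical \<psi>_reg[OF f]] \<delta>.vertical_nilpotency[OF _ \<psi>_reg[OF f]]
    by simp
  then show ?thesis using zero_iff[OF f] by simp
qed

lemma pullback_filtration_subset:
  assumes can: "canonical_LND k d s D" and \<psi>: "morphism X X \<psi>" and \<phi>: "morphism X X \<phi>"
    and inv: "\<And>p. p \<in> X \<Longrightarrow> \<phi> (\<psi> p) = p" "\<And>p. p \<in> X \<Longrightarrow> \<psi> (\<phi> p) = p"
  shows "pullback X \<psi> ` filtration X D i \<subseteq> filtration X D i"
proof (rule image_subsetI)
  fix f assume f: "f \<in> filtration X D i"
  show "pullback X \<psi> f \<in> filtration X D i"
  proof (cases "f = (\<lambda>p\<in>X. 0)")
    case True
    then have "pullback X \<psi> f = (\<lambda>p\<in>X. 0)"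
      using \<psi> by (auto simp: pullback_def morphism_def Pi_iff intro!: restrict_ext)
    then show ?thesis by (simp add: filtration_def)
  next
    case False
    then have reg: "f \<in> regular_functions X" and deg: "int (degree_fun X D f) \<le> i"
      using f by (auto simp: filtration_def)
    note iff = canonical_nilpotency_pullback[OF assms reg]
    have "degree_fun X D (pullback X \<psi> f) = degree_fun X D f"
      by (simp only: degree_fun_def iff)
    moreover have "pullback X \<psi> f \<noteq> (\<lambda>p\<in>X. 0)" using iff[of 0] False by simp
    ultimately show ?thesis
      using deg pullback_regular[OF \<psi> reg] by (simp add: filtration_def)
  qed
qed

end

theorem lemma7p5:
  fixes k :: "'n::finite \<Rightarrow> nat"
    and d :: nat
    and s :: "nat \<Rightarrow> ('n \<Rightarrow>\<^sub>0 nat) \<Rightarrow>\<^sub>0 'k::{alg_closed_field, field_char_0}"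
    and D :: "(('n coord \<Rightarrow> 'k) \<Rightarrow> 'k) \<Rightarrow> (('n coord \<Rightarrow> 'k) \<Rightarrow> 'k)"
    and \<psi> :: "('n coord \<Rightarrow> 'k) \<Rightarrow> ('n coord \<Rightarrow> 'k)"
    and i :: int
  assumes "d \<ge> 2"
    and "\<And>j. k j \<ge> 2"
    and "canonical_LND k d s D"
    and "automorphism (danielewski k d s) \<psi>"
  shows "pullback (danielewski k d s) \<psi> ` filtration (danielewski k d s) D i =
         filtration (danielewski k d s) D i"
proof -
  interpret danielewski_variety k d s using assms(1,2) by unfold_locales
  obtain \<phi> where \<psi>: "morphism X X \<psi>" and \<phi>: "morphism X X \<phi>"
    and inv: "\<And>p. p \<in> X \<Longrightarrow> \<phi> (\<psi> p) = p" "\<And>p. p \<in> X \<Longrightarrow> \<psi> (\<phi> p) = p"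
    using assms(4) unfolding automorphism_def X_def by blast
  have "filtration X D i \<subseteq> pullback X \<psi> ` filtration X D i"
  proof
    fix f assume f: "f \<in> filtration X D i"
    then have "f \<in> regular_functions X" by (auto simp: filtration_def)
    then have "f = pullback X \<psi> (pullback X \<phi> f)" by (simp add: pullback_inverse[OF \<psi> inv(1)])
    moreover have "pullback X \<phi> f \<in> filtration X D i"
      using pullback_filtration_subset[OF assms(3) \<phi> \<psi> inv(2,1)] f by blast
    ultimately show "f \<in> pullback X \<psi> ` filtration X D i" by blast
  qed
  with pullback_filtration_subset[OF assms(3) \<psi> \<phi> inv] show ?thesis
    unfolding X_def by blast
qed

end
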